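(* Let $(\mathcal M,g)$ be an $n$-dimensional pseudo-Riemannian manifold and let $\xi$ be a non-isotropic vector field on $\mathcal M$, i.e. $g(\xi,\xi)\neq0$ at every point. Write the characteristic polynomial of the Jacobi operator $J_\xi$ as $$\chi(\xi,x)=\det(x\,\mathrm{Id}-J_\xi)=x^n-\omega_1(\xi)x^{n-1}+\cdots+(-1)^{n-1}\omega_{n-1}(\xi)\,x .$$ Then $J_\xi$ has maximal rank (that is, rank $n-1$ at every point) if and only if the coefficient $\omega_{n-1}(\xi)$ at the lowest power term is non-zero (at every point).
   Context: All objects are smooth. $\nabla$ is the Levi-Civita connection of $g$, and $R_{XY}Z=\nabla_X\nabla_YZ-\nabla_Y\nabla_XZ-\nabla_{[X,Y]}Z$. The Jacobi operator of $\xi$ is the $(1,1)$-tensor field $J_\xi:X\mapsto R_{X\xi}\xi$. Since $J_\xi\xi=0$, for $\xi\ne 0$ its rank at each point is at most $n-1$ and its characteristic polynomial has no constant term; it has maximal rank if its rank is $n-1$. The functions $\omega_i(\xi)$ are defined by the displayed characteristic polynomial. *)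

theory Defs
  imports "HOL-Analysis.Analysis" "HOL-Library.Function_Algebras"
    "HOL-Computational_Algebra.Polynomial"
begin

instantiation "fun" :: (type, scaleR) scaleR
begin

definition scaleR_fun_def: "scaleR r f = (\<lambda>x. scaleR r (f x))"

instance ..

end

instance "fun" :: (type, real_vector) real_vector
  by standard
    (simp_all add: scaleR_fun_def fun_eq_iff scaleR_add_right scaleR_add_left)

text \<open>The set is always open below, so derivatives are taken in the full neighbourhood.\<close>

primrec Ck_on ::
  "nat \<Rightarrow> 'e::euclidean_space set \<Rightarrow> ('e \<Rightarrow> 'f::real_normed_vector) \<Rightarrow> bool" where
  "Ck_on 0 S f \<longleftrightarrow> continuous_on S f"
| "Ck_on (Suc k) S f \<longleftrightarrow>
     (\<forall>x\<in>S. f differentiable (at x)) \<and>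
     (\<forall>v. Ck_on k S (\<lambda>x. frechet_derivative f (at x) v))"

definition smooth_on ::
  "'e::euclidean_space set \<Rightarrow> ('e \<Rightarrow> 'f::real_normed_vector) \<Rightarrow> bool" where
  "smooth_on S f \<longleftrightarrow> (\<forall>k. Ck_on k S f)"

text \<open>A chart is a pair of a domain and a coordinate map; the values of the coordinate
  map outside the domain are irrelevant.\<close>

type_synonym ('a, 'n) chart = "'a set \<times> ('a \<Rightarrow> real^'n)"

definition chart_inv :: "('a, 'n) chart \<Rightarrow> real^'n \<Rightarrow> 'a" where
  "chart_inv c = inv_into (fst c) (snd c)"

definition transition :: "('a, 'n) chart \<Rightarrow> ('a, 'n) chart \<Rightarrow> real^'n \<Rightarrow> real^'n" where
  "transition c c' = snd c' \<circ> chart_inv c"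

definition smooth_manifold :: "'a topology \<Rightarrow> ('a, 'n::finite) chart set \<Rightarrow> bool" where
  "smooth_manifold T A \<longleftrightarrow>
     Hausdorff_space T \<and> second_countable T \<and>
     (\<forall>c\<in>A. openin T (fst c) \<and> open (snd c ` fst c) \<and>
        homeomorphic_map (subtopology T (fst c)) (top_of_set (snd c ` fst c)) (snd c)) \<and>
     (\<Union>c\<in>A. fst c) = topspace T \<and>
     (\<forall>c\<in>A. \<forall>c'\<in>A. smooth_on (snd c ` (fst c \<inter> fst c')) (transition c c'))"

definition charts_at :: "('a, 'n) chart set \<Rightarrow> 'a \<Rightarrow> ('a, 'n) chart set" where
  "charts_at A p = {c \<in> A. p \<in> fst c}"

definition smooth_functions :: "('a, 'n::finite) chart set \<Rightarrow> ('a \<Rightarrow> real) set" where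
  "smooth_functions A = {f. \<forall>c\<in>A. smooth_on (snd c ` fst c) (f \<circ> chart_inv c)}"

text \<open>A tangent vector at \<open>p\<close> is given by its coordinate vectors in all charts around \<open>p\<close>,
  related by the differentials of the transition maps. The coordinate vectors in the other
  charts are set to zero, so that the tangent vectors at \<open>p\<close> form a vector space of dimension
  \<open>CARD('n)\<close> if \<open>p\<close> is a point of the manifold; otherwise they form the zero space.\<close>

type_synonym ('a, 'n) tangent = "('a, 'n) chart \<Rightarrow> real^'n"

definition tangent_space ::
  "('a, 'n::finite) chart set \<Rightarrow> 'a \<Rightarrow> ('a, 'n) tangent set" where
  "tangent_space A p = {v.
     (\<forall>c. c \<notin> charts_at A p \<longrightarrow> v c = 0) \<and>
     (\<forall>c\<in>charts_at A p. \<forall>c'\<in>charts_at A p.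
        v c' = frechet_derivative (transition c c') (at (snd c p)) (v c))}"

type_synonym ('a, 'n) vfield = "'a \<Rightarrow> ('a, 'n) tangent"

definition vf_coords :: "('a, 'n) vfield \<Rightarrow> ('a, 'n) chart \<Rightarrow> real^'n \<Rightarrow> real^'n" where
  "vf_coords X c = (\<lambda>x. X (chart_inv c x) c)"

definition vector_fields :: "('a, 'n::finite) chart set \<Rightarrow> ('a, 'n) vfield set" where
  "vector_fields A = {X.
     (\<forall>p. X p \<in> tangent_space A p) \<and>
     (\<forall>c\<in>A. smooth_on (snd c ` fst c) (vf_coords X c))}"

text \<open>The derivative of \<open>f\<close> in direction \<open>v\<close>; it does not depend on the chart chosen.\<close>

definition dir_deriv ::
  "('a, 'n::finite) chart set \<Rightarrow> 'a \<Rightarrow> ('a, 'n) tangent \<Rightarrow> ('a \<Rightarrow> real) \<Rightarrow> real" where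
  "dir_deriv A p v f =
     (let c = (SOME c. c \<in> charts_at A p)
      in frechet_derivative (f \<circ> chart_inv c) (at (snd c p)) (v c))"

text \<open>In coordinates, \<open>[X, Y]\<^sup>k = X\<^sup>i \<partial>\<^sub>i Y\<^sup>k - Y\<^sup>i \<partial>\<^sub>i X\<^sup>k\<close>.\<close>

definition lie_bracket ::
  "('a, 'n::finite) chart set \<Rightarrow> ('a, 'n) vfield \<Rightarrow> ('a, 'n) vfield \<Rightarrow> ('a, 'n) vfield" where
  "lie_bracket A X Y = (\<lambda>p c.
     if c \<in> charts_at A p
     then frechet_derivative (vf_coords Y c) (at (snd c p)) (X p c)
        - frechet_derivative (vf_coords X c) (at (snd c p)) (Y p c)
     else 0)"

text \<open>The values of \<open>g p\<close> matter only on the tangent space at \<open>p\<close>.\<close>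

type_synonym ('a, 'n) metric = "'a \<Rightarrow> ('a, 'n) tangent \<Rightarrow> ('a, 'n) tangent \<Rightarrow> real"

definition pseudo_riemannian_metric ::
  "('a, 'n::finite) chart set \<Rightarrow> ('a, 'n) metric \<Rightarrow> bool" where
  "pseudo_riemannian_metric A g \<longleftrightarrow>
     (\<forall>p. \<forall>u\<in>tangent_space A p. \<forall>v\<in>tangent_space A p. \<forall>w\<in>tangent_space A p. \<forall>a b.
        g p (a *\<^sub>R u + b *\<^sub>R v) w = a * g p u w + b * g p v w) \<and>
     (\<forall>p. \<forall>u\<in>tangent_space A p. \<forall>v\<in>tangent_space A p. g p u v = g p v u) \<and>
     (\<forall>p. \<forall>u\<in>tangent_space A p. (\<forall>v\<in>tangent_space A p. g p u v = 0) \<longrightarrow> u = 0) \<and>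
     (\<forall>X\<in>vector_fields A. \<forall>Y\<in>vector_fields A.
        (\<lambda>p. g p (X p) (Y p)) \<in> smooth_functions A)"

type_synonym ('a, 'n) connection =
  "('a, 'n) vfield \<Rightarrow> ('a, 'n) vfield \<Rightarrow> ('a, 'n) vfield"

definition affine_connection ::
  "('a, 'n::finite) chart set \<Rightarrow> ('a, 'n) connection \<Rightarrow> bool" where
  "affine_connection A nabla \<longleftrightarrow>
     (\<forall>X\<in>vector_fields A. \<forall>Y\<in>vector_fields A. nabla X Y \<in> vector_fields A) \<and>
     (\<forall>X\<in>vector_fields A. \<forall>Y\<in>vector_fields A. \<forall>Z\<in>vector_fields A.
        nabla (X + Y) Z = nabla X Z + nabla Y Z \<and>
        nabla X (Y + Z) = nabla X Y + nabla X Z) \<and>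
     (\<forall>f\<in>smooth_functions A. \<forall>X\<in>vector_fields A. \<forall>Y\<in>vector_fields A.
        nabla (\<lambda>p. f p *\<^sub>R X p) Y = (\<lambda>p. f p *\<^sub>R nabla X Y p) \<and>
        nabla X (\<lambda>p. f p *\<^sub>R Y p) =
          (\<lambda>p. f p *\<^sub>R nabla X Y p + dir_deriv A p (X p) f *\<^sub>R Y p))"

definition levi_civita ::
  "('a, 'n::finite) chart set \<Rightarrow> ('a, 'n) metric \<Rightarrow> ('a, 'n) connection \<Rightarrow> bool" where
  "levi_civita A g nabla \<longleftrightarrow>
     affine_connection A nabla \<and>
     (\<forall>X\<in>vector_fields A. \<forall>Y\<in>vector_fields A.
        nabla X Y - nabla Y X = lie_bracket A X Y) \<and>
     (\<forall>X\<in>vector_fields A. \<forall>Y\<in>vector_fields A. \<forall>Z\<in>vector_fields A. \<forall>p\<in>\<Union>(fst ` A).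
        dir_deriv A p (X p) (\<lambda>q. g q (Y q) (Z q)) =
          g p (nabla X Y p) (Z p) + g p (Y p) (nabla X Z p))"

definition curvature ::
  "('a, 'n::finite) chart set \<Rightarrow> ('a, 'n) connection \<Rightarrow>
     ('a, 'n) vfield \<Rightarrow> ('a, 'n) vfield \<Rightarrow> ('a, 'n) vfield \<Rightarrow> ('a, 'n) vfield" where
  "curvature A nabla X Y Z =
     nabla X (nabla Y Z) - nabla Y (nabla X Z) - nabla (lie_bracket A X Y) Z"

text \<open>By tensoriality, \<open>(R\<^bsub>X\<xi>\<^esub> \<xi>) p\<close> depends on the field \<open>X\<close> only through \<open>X p\<close>, and every tangent
  vector at \<open>p\<close> is the value of a field; hence \<open>J\<^sub>\<xi>\<close> is an endomorphism of the tangent space.\<close>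

definition jacobi_operator ::
  "('a, 'n::finite) chart set \<Rightarrow> ('a, 'n) connection \<Rightarrow> ('a, 'n) vfield \<Rightarrow>
     'a \<Rightarrow> ('a, 'n) tangent \<Rightarrow> ('a, 'n) tangent" where
  "jacobi_operator A nabla \<xi> p v =
     (THE w. \<exists>X\<in>vector_fields A. X p = v \<and> w = curvature A nabla X \<xi> \<xi> p)"

definition jacobi_rank ::
  "('a, 'n::finite) chart set \<Rightarrow> ('a, 'n) connection \<Rightarrow> ('a, 'n) vfield \<Rightarrow> 'a \<Rightarrow> nat" where
  "jacobi_rank A nabla \<xi> p = dim (jacobi_operator A nabla \<xi> p ` tangent_space A p)"

definition is_basis :: "'v::real_vector set \<Rightarrow> ('n::finite \<Rightarrow> 'v) \<Rightarrow> bool" where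
  "is_basis S b \<longleftrightarrow> inj b \<and> independent (range b) \<and> span (range b) = S"

definition endo_matrix ::
  "('n::finite \<Rightarrow> 'v::real_vector) \<Rightarrow> ('v \<Rightarrow> 'v) \<Rightarrow> real^'n^'n" where
  "endo_matrix b f = (\<chi> i j. representation (range b) (f (b j)) (b i))"

definition char_poly :: "real^'n^'n::finite \<Rightarrow> real poly" where
  "char_poly M = det (mat [:0, 1:] - (\<chi> i j. [:M $ i $ j:]))"

text \<open>The characteristic polynomial does not depend on the basis chosen.\<close>

definition jacobi_char_poly ::
  "('a, 'n::finite) chart set \<Rightarrow> ('a, 'n) connection \<Rightarrow> ('a, 'n) vfield \<Rightarrow> 'a \<Rightarrow> real poly" where
  "jacobi_char_poly A nabla \<xi> p =
     (let b = (SOME b :: 'n \<Rightarrow> ('a, 'n) tangent. is_basis (tangent_space A p) b)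
      in char_poly (endo_matrix b (jacobi_operator A nabla \<xi> p)))"

text \<open>\<open>\<chi>(\<xi>, x) = x\<^sup>n - \<omega>\<^sub>1(\<xi>) x\<^bsup>n-1\<^esup> + \<dots> + (-1)\<^bsup>n-1\<^esup> \<omega>\<^bsub>n-1\<^esub>(\<xi>) x\<close>, so \<open>(-1)\<^sup>i \<omega>\<^sub>i(\<xi>)\<close> is the coefficient
  of \<open>x\<^bsup>n-i\<^esup>\<close>; only \<open>i \<le> n\<close> is meaningful.\<close>

definition jacobi_omega ::
  "('a, 'n::finite) chart set \<Rightarrow> ('a, 'n) connection \<Rightarrow> nat \<Rightarrow> ('a, 'n) vfield \<Rightarrow> 'a \<Rightarrow> real" where
  "jacobi_omega A nabla i \<xi> p =
     (-1) ^ i * coeff (jacobi_char_poly A nabla \<xi> p) (CARD('n) - i)"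

end

theory Submission
  imports Defs
begin

text \<open>
The equivalence holds at every point \<open>p\<close> separately, and it is linear algebra once two
properties of the Jacobi operator \<open>J = J\<^sub>\<xi>\<close> at \<open>p\<close> are known: \<open>J \<xi> = 0\<close>, and the image of \<open>J\<close> is
orthogonal to \<open>\<xi>\<close>. Let \<open>y\<close> be the covector \<open>g(\<cdot>, \<xi>)\<close>. Then \<open>y \<circ> J = 0\<close> and \<open>J \<xi> = 0\<close>, while
\<open>y(\<xi>) \<noteq> 0\<close> because \<open>\<xi>\<close> is not isotropic; so the tangent space splits into the line of \<open>\<xi>\<close>, which
\<open>J\<close> kills, and the hyperplane \<open>ker y\<close>, on which \<open>J\<close> has the same image as on the whole space.
Hence \<open>J\<close> has rank \<open>n - 1\<close> iff \<open>ker J \<inter> ker y\<close> is trivial. On the other side, pick a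
coordinate \<open>k\<close> with \<open>y\<^sub>k \<noteq> 0\<close>. Combining the rows of \<open>x Id - J\<close> with weights \<open>y\<close> gives \<open>x y\<close>, so
\<open>y\<^sub>k \<chi>(x)\<close> is \<open>x\<close> times the determinant of \<open>x Id - J\<close> with row \<open>k\<close> replaced by \<open>y\<close>. The coefficient
\<open>\<plusminus> \<omega>\<^bsub>n-1\<^esub>\<close> of \<open>x\<close> in \<open>\<chi>\<close> is therefore, up to the factor \<open>y\<^sub>k\<close>, the determinant of \<open>- J\<close> with
row \<open>k\<close> replaced by \<open>y\<close>, a matrix whose kernel is again \<open>ker J \<inter> ker y\<close>. This is
\<open>rank_eq_iff_coeff_1_char_poly\<close>, transported to an arbitrary basis by
\<open>dim_image_eq_iff_coeff_1_char_poly\<close>.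

Orthogonality to \<open>\<xi>\<close> is the identity \<open>g(R\<^bsub>XY\<^esub> Z, Z) = 0\<close> (\<open>metric_curvature_skew\<close>): by metric
compatibility, \<open>2 g(R\<^bsub>XY\<^esub> Z, Z)\<close> is \<open>X Y h - Y X h - [X, Y] h\<close> for the function \<open>h = g(Z, Z)\<close>.
That this vanishes (\<open>dir_deriv_lie_bracket\<close>) is the symmetry of second derivatives, which is
derived here from the mean value theorem.

Since \<open>J v\<close> is defined by extending \<open>v\<close> to a field, linearity of \<open>J\<close> and its values at
particular vectors need that extensions exist and that \<open>R\<^bsub>X\<xi>\<^esub> \<xi>\<close> at \<open>p\<close> depends on \<open>X\<close> only through
\<open>X p\<close>. Both use smooth bump functions, built from \<open>exp (- 1 / t)\<close>, to turn fields and functions that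
are given in a chart into global ones (\<open>vector_field_through\<close>, \<open>curvature_eq_0_at\<close>).
\<close>

section \<open>Calculus of smooth maps\<close>

text \<open>Differentiability at a point of an open set only sees the values near that point.\<close>

lemma Ck_on_cong_imp:
  assumes "open S" "\<And>x. x \<in> S \<Longrightarrow> f x = g x" "Ck_on k S f"
  shows "Ck_on k S g"
  using assms(2,3)
proof (induction k arbitrary: f g)
  case 0
  then show ?case using continuous_on_cong by (metis Ck_on.simps(1))
next
  case (Suc k)
  have der: "(g has_derivative frechet_derivative f (at x)) (at x)" if "x \<in> S" for x
  proof (rule has_derivative_transform_within_open[of f _ x UNIV S])
    show "(f has_derivative frechet_derivative f (at x)) (at x)"
      using Suc.prems(2) that by (simp add: frechet_derivative_works)
  qed (use assms(1) that Suc.prems(1) in auto)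
  have eq: "frechet_derivative f (at x) = frechet_derivative g (at x)" if "x \<in> S" for x
    using frechet_derivative_at[OF der[OF that]] .
  have "Ck_on k S (\<lambda>x. frechet_derivative g (at x) v)" for v
    by (rule Suc.IH[of "\<lambda>x. frechet_derivative f (at x) v"]) (use eq Suc.prems(2) in auto)
  then show ?case using der by (auto simp: differentiable_def)
qed

text \<open>Replaces \<open>frechet_derivative\<close>, which is defined by choice, by any explicitly given
derivative.\<close>

lemma Ck_on_SucI:
  assumes "open S" "\<And>x. x \<in> S \<Longrightarrow> (f has_derivative f' x) (at x)"
    "\<And>v. Ck_on k S (\<lambda>x. f' x v)"
  shows "Ck_on (Suc k) S f"
proof -
  have "Ck_on k S (\<lambda>x. frechet_derivative f (at x) v)" for v
    by (rule Ck_on_cong_imp[OF assms(1) _ assms(3)[of v]])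
       (use frechet_derivative_at[OF assms(2)] in auto)
  then show ?thesis using assms(2) by (auto simp: differentiable_def)
qed

lemma Ck_on_SucD:
  assumes "Ck_on (Suc k) S f" "x \<in> S"
  shows "(f has_derivative frechet_derivative f (at x)) (at x)"
  using assms by (simp add: frechet_derivative_works)

lemma Ck_on_Suc_imp:
  assumes "Ck_on (Suc k) S f"
  shows "Ck_on k S f"
  using assms
proof (induction k arbitrary: f)
  case 0
  then show ?case
    by (auto intro!: continuous_at_imp_continuous_on differentiable_imp_continuous_within)
next
  case (Suc k)
  then show ?case by (metis Ck_on.simps(2))
qed

lemma Ck_on_subset: "Ck_on k S f \<Longrightarrow> U \<subseteq> S \<Longrightarrow> Ck_on k U f"
  by (induction k arbitrary: f) (auto intro: continuous_on_subset)

lemma Ck_on_Un: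
  assumes "open S" "open U"
  shows "Ck_on k S f \<Longrightarrow> Ck_on k U f \<Longrightarrow> Ck_on k (S \<union> U) f"
  by (induction k arbitrary: f) (auto intro: continuous_on_open_Un assms)

lemma Ck_on_const: "Ck_on k S (\<lambda>x. c)"
  by (induction k arbitrary: c) auto

lemma Ck_on_bounded_linear_comp:
  assumes "open S" "bounded_linear L" "Ck_on k S f"
  shows "Ck_on k S (\<lambda>x. L (f x))"
  using assms(3)
proof (induction k arbitrary: f)
  case 0
  then show ?case using assms(2) by (auto intro: bounded_linear.continuous_on)
next
  case (Suc k)
  show ?case
    by (rule Ck_on_SucI[OF assms(1) bounded_linear.has_derivative[OF assms(2) Ck_on_SucD[OF Suc.prems]]])
       (use Suc in auto)
qed

lemma Ck_on_add:
  assumes "open S" "Ck_on k S f" "Ck_on k S g"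
  shows "Ck_on k S (\<lambda>x. f x + g x)"
  using assms(2,3)
proof (induction k arbitrary: f g)
  case 0
  then show ?case by (auto intro: continuous_on_add)
next
  case (Suc k)
  show ?case
    by (rule Ck_on_SucI[OF assms(1) has_derivative_add[OF Ck_on_SucD[OF Suc.prems(1)] Ck_on_SucD[OF Suc.prems(2)]]])
       (use Suc in auto)
qed

lemma Ck_on_sum:
  assumes "open S" "finite I" "\<And>i. i \<in> I \<Longrightarrow> Ck_on k S (f i)"
  shows "Ck_on k S (\<lambda>x. \<Sum>i\<in>I. f i x)"
  using assms(2,3) by (induction I rule: finite_induct) (auto intro: Ck_on_const Ck_on_add assms(1))

text \<open>The product rule turns the derivative into a sum of two terms of the same shape, in which
one factor is of class \<open>C\<^sup>k\<close> and the other is a derivative.\<close>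

lemma Ck_on_bounded_bilinear:
  assumes "open S" "bounded_bilinear h" "Ck_on k S f" "Ck_on k S g"
  shows "Ck_on k S (\<lambda>x. h (f x) (g x))"
  using assms(3,4)
proof (induction k arbitrary: f g)
  case 0
  then show ?case using assms(2) by (auto intro: bounded_bilinear.continuous_on)
next
  case (Suc k)
  note c = Suc.prems[THEN Ck_on_Suc_imp]
  show ?case
    by (rule Ck_on_SucI[OF assms(1) bounded_bilinear.FDERIV[OF assms(2) Ck_on_SucD[OF Suc.prems(1)] Ck_on_SucD[OF Suc.prems(2)]]])
       (use Suc c in \<open>auto intro!: Ck_on_add assms(1)\<close>)
qed

lemma linear_Basis_expansion:
  fixes L :: "'e::euclidean_space \<Rightarrow> 'f::real_vector"
  assumes "linear L"
  shows "L v = (\<Sum>b\<in>Basis. (v \<bullet> b) *\<^sub>R L b)"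
proof -
  have "L v = L (\<Sum>b\<in>Basis. (v \<bullet> b) *\<^sub>R b)" by (simp add: euclidean_representation)
  also have "\<dots> = (\<Sum>b\<in>Basis. (v \<bullet> b) *\<^sub>R L b)" using assms by (simp add: linear_sum linear_cmul)
  finally show ?thesis .
qed

text \<open>The class of \<open>Ck_on\<close> refers to derivatives in constant directions; expanding a varying
direction in the standard basis reduces to these.\<close>

lemma Ck_on_apply_derivative:
  fixes f :: "'e::euclidean_space \<Rightarrow> 'f::real_normed_vector"
  assumes "open S" "Ck_on (Suc k) S f" "Ck_on k S w"
  shows "Ck_on k S (\<lambda>x. frechet_derivative f (at x) (w x))"
proof (rule Ck_on_cong_imp[OF assms(1)])
  show "(\<Sum>b\<in>Basis. (w x \<bullet> b) *\<^sub>R frechet_derivative f (at x) b) = frechet_derivative f (at x) (w x)"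
    if "x \<in> S" for x
    using assms(2) that
    by (intro linear_Basis_expansion[symmetric] linear_frechet_derivative) auto
  show "Ck_on k S (\<lambda>x. \<Sum>b\<in>Basis. (w x \<bullet> b) *\<^sub>R frechet_derivative f (at x) b)"
    using assms(2)
    by (intro Ck_on_sum assms Ck_on_bounded_bilinear[OF _ bounded_bilinear_scaleR]
          Ck_on_bounded_linear_comp[OF _ bounded_linear_inner_left]) auto
qed

text \<open>By the chain rule and the expansion of \<open>Df(x) v\<close> in the standard basis, the derivative of
\<open>g \<circ> f\<close> is a sum of products of a derivative of \<open>f\<close> with a partial derivative of \<open>g\<close> composed with
\<open>f\<close>; the induction hypothesis applies to the latter because \<open>g\<close> is generalized.\<close>

lemma Ck_on_compose:
  fixes g :: "'f::euclidean_space \<Rightarrow> 'h::real_normed_vector"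
  assumes "open S" "open U" "f ` S \<subseteq> U" "Ck_on k S f" "Ck_on k U g"
  shows "Ck_on k S (\<lambda>x. g (f x))"
  using assms(4,5)
proof (induction k arbitrary: g)
  case 0
  then show ?case using assms(3) by (auto intro: continuous_on_compose2)
next
  case (Suc k)
  have fU: "x \<in> S \<Longrightarrow> f x \<in> U" for x using assms(3) by auto
  show ?case
  proof (rule Ck_on_SucI[OF assms(1)])
    show "((\<lambda>x. g (f x)) has_derivative
        (\<lambda>v. \<Sum>b\<in>Basis. (frechet_derivative f (at x) v \<bullet> b) *\<^sub>R frechet_derivative g (at (f x)) b)) (at x)"
      if "x \<in> S" for x
    proof -
      have g: "(g has_derivative frechet_derivative g (at (f x))) (at (f x))"
        by (rule Ck_on_SucD[OF Suc.prems(2) fU[OF that]])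
      have "(\<lambda>v. frechet_derivative g (at (f x)) (frechet_derivative f (at x) v)) =
        (\<lambda>v. \<Sum>b\<in>Basis. (frechet_derivative f (at x) v \<bullet> b) *\<^sub>R frechet_derivative g (at (f x)) b)"
        using linear_Basis_expansion[OF has_derivative_linear[OF g]] by blast
      then show ?thesis
        using has_derivative_compose[OF Ck_on_SucD[OF Suc.prems(1) that] g] by simp
    qed
    show "Ck_on k S (\<lambda>x. \<Sum>b\<in>Basis. (frechet_derivative f (at x) v \<bullet> b) *\<^sub>R frechet_derivative g (at (f x)) b)" for v
      using Suc.prems Ck_on_Suc_imp[OF Suc.prems(1)]
        Suc.IH[of "\<lambda>y. frechet_derivative g (at y) b" for b]
      by (intro Ck_on_sum assms Ck_on_bounded_bilinear[OF _ bounded_bilinear_scaleR]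
          Ck_on_bounded_linear_comp[OF _ bounded_linear_inner_left]) auto
  qed
qed

lemma smooth_on_cong:
  assumes "open S" "\<And>x. x \<in> S \<Longrightarrow> f x = g x" "smooth_on S f"
  shows "smooth_on S g"
  using assms Ck_on_cong_imp unfolding smooth_on_def by blast

lemma smooth_on_subset: "smooth_on S f \<Longrightarrow> U \<subseteq> S \<Longrightarrow> smooth_on U f"
  using Ck_on_subset unfolding smooth_on_def by blast

lemma smooth_on_Un:
  "open S \<Longrightarrow> open U \<Longrightarrow> smooth_on S f \<Longrightarrow> smooth_on U f \<Longrightarrow> smooth_on (S \<union> U) f"
  using Ck_on_Un unfolding smooth_on_def by blast

lemma smooth_on_const: "smooth_on S (\<lambda>x. c)"
  using Ck_on_const unfolding smooth_on_def by blast

lemma smooth_on_bounded_linear_comp: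
  "open S \<Longrightarrow> bounded_linear L \<Longrightarrow> smooth_on S f \<Longrightarrow> smooth_on S (\<lambda>x. L (f x))"
  using Ck_on_bounded_linear_comp unfolding smooth_on_def by blast

lemma smooth_on_add:
  "open S \<Longrightarrow> smooth_on S f \<Longrightarrow> smooth_on S g \<Longrightarrow> smooth_on S (\<lambda>x. f x + g x)"
  using Ck_on_add unfolding smooth_on_def by blast

lemma smooth_on_bounded_bilinear:
  assumes "open S" "bounded_bilinear h" "smooth_on S f" "smooth_on S g"
  shows "smooth_on S (\<lambda>x. h (f x) (g x))"
  using assms Ck_on_bounded_bilinear unfolding smooth_on_def by blast

lemmas smooth_on_scaleR = smooth_on_bounded_bilinear[OF _ bounded_bilinear_scaleR]

lemma smooth_on_apply_derivative:
  "open S \<Longrightarrow> smooth_on S f \<Longrightarrow> smooth_on S w \<Longrightarrow>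
    smooth_on S (\<lambda>x. frechet_derivative f (at x) (w x))"
  using Ck_on_apply_derivative unfolding smooth_on_def by blast

lemma smooth_on_compose:
  "open S \<Longrightarrow> open U \<Longrightarrow> f ` S \<subseteq> U \<Longrightarrow> smooth_on S f \<Longrightarrow> smooth_on U g \<Longrightarrow> smooth_on S (\<lambda>x. g (f x))"
  using Ck_on_compose unfolding smooth_on_def by blast

lemma smooth_on_has_derivative:
  "smooth_on S f \<Longrightarrow> x \<in> S \<Longrightarrow> (f has_derivative frechet_derivative f (at x)) (at x)"
  using Ck_on_SucD unfolding smooth_on_def by blast

lemma DERIV_along_line:
  fixes F :: "'e::euclidean_space \<Rightarrow> real"
  assumes "F differentiable (at (x + s *\<^sub>R u))"
  shows "((\<lambda>s. F (x + s *\<^sub>R u)) has_real_derivative frechet_derivative F (at (x + s *\<^sub>R u)) u) (at s)"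
proof -
  have F: "(F has_derivative frechet_derivative F (at (x + s *\<^sub>R u))) (at (x + s *\<^sub>R u))"
    using assms by (simp add: frechet_derivative_works)
  have "((\<lambda>s. x + s *\<^sub>R u) has_derivative (\<lambda>r. r *\<^sub>R u)) (at s)"
    by (auto intro!: derivative_eq_intros)
  from has_derivative_compose[OF this F]
  have "((\<lambda>s. F (x + s *\<^sub>R u)) has_derivative (\<lambda>r. frechet_derivative F (at (x + s *\<^sub>R u)) (r *\<^sub>R u))) (at s)" .
  moreover have "(\<lambda>r. frechet_derivative F (at (x + s *\<^sub>R u)) (r *\<^sub>R u)) =
      (*) (frechet_derivative F (at (x + s *\<^sub>R u)) u)"
    using linear_cmul[OF has_derivative_linear[OF F]] by auto
  ultimately show ?thesis by (simp add: has_field_derivative_def)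
qed

text \<open>The second difference of \<open>f\<close> over a parallelogram is symmetric in its two sides, whereas the
right-hand side takes the derivatives in a definite order. It comes from the mean value theorem in
direction \<open>u\<close>, applied to the difference in direction \<open>v\<close>, and then in direction \<open>v\<close>.\<close>

lemma second_difference_mvt:
  fixes f :: "'e::euclidean_space \<Rightarrow> real"
  assumes "Ck_on 2 S f" "h > 0"
    and in_S: "\<And>s t. 0 \<le> s \<Longrightarrow> s \<le> h \<Longrightarrow> 0 \<le> t \<Longrightarrow> t \<le> h \<Longrightarrow> x + s *\<^sub>R u + t *\<^sub>R v \<in> S"
  obtains s t where "0 < s" "s < h" "0 < t" "t < h"
    "f (x + h *\<^sub>R u + h *\<^sub>R v) - f (x + h *\<^sub>R u) - f (x + h *\<^sub>R v) + f x =
      h\<^sup>2 * frechet_derivative (\<lambda>y. frechet_derivative f (at y) u) (at (x + s *\<^sub>R u + t *\<^sub>R v)) v"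
proof -
  define Du where "Du = (\<lambda>y. frechet_derivative f (at y) u)"
  have C: "Ck_on (Suc (Suc 0)) S f" using assms(1) by (simp only: numeral_2_eq_2)
  have df: "f differentiable (at y)" if "y \<in> S" for y using C that by auto
  have dDu: "Du differentiable (at y)" if "y \<in> S" for y using C that by (auto simp: Du_def)
  have 1: "((\<lambda>s. f ((x + h *\<^sub>R v) + s *\<^sub>R u) - f (x + s *\<^sub>R u)) has_real_derivative
      (Du (x + h *\<^sub>R v + s *\<^sub>R u) - Du (x + s *\<^sub>R u))) (at s)" if "0 \<le> s" "s \<le> h" for s
    unfolding Du_def
    using in_S[of s h] in_S[of s 0] that \<open>h > 0\<close>
    by (intro DERIV_diff DERIV_along_line df) (auto simp: algebra_simps)
  obtain s where s: "0 < s" "s < h" and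
    eq1: "(f ((x + h *\<^sub>R v) + h *\<^sub>R u) - f (x + h *\<^sub>R u)) - (f ((x + h *\<^sub>R v) + 0 *\<^sub>R u) - f (x + 0 *\<^sub>R u))
      = (h - 0) * (Du (x + h *\<^sub>R v + s *\<^sub>R u) - Du (x + s *\<^sub>R u))"
    using MVT2[OF \<open>h > 0\<close> 1] by blast
  have 2: "((\<lambda>t. Du ((x + s *\<^sub>R u) + t *\<^sub>R v)) has_real_derivative
      frechet_derivative Du (at (x + s *\<^sub>R u + t *\<^sub>R v)) v) (at t)" if "0 \<le> t" "t \<le> h" for t
    using in_S[of s t] s that by (intro DERIV_along_line dDu) auto
  obtain t where t: "0 < t" "t < h" and
    eq2: "Du (x + s *\<^sub>R u + h *\<^sub>R v) - Du (x + s *\<^sub>R u + 0 *\<^sub>R v)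
      = (h - 0) * frechet_derivative Du (at (x + s *\<^sub>R u + t *\<^sub>R v)) v"
    using MVT2[OF \<open>h > 0\<close> 2] by blast
  show ?thesis
  proof (rule that[OF s t])
    have "x + h *\<^sub>R v + s *\<^sub>R u = x + s *\<^sub>R u + h *\<^sub>R v" "x + h *\<^sub>R v + h *\<^sub>R u = x + h *\<^sub>R u + h *\<^sub>R v" by auto
    then show "f (x + h *\<^sub>R u + h *\<^sub>R v) - f (x + h *\<^sub>R u) - f (x + h *\<^sub>R v) + f x =
      h\<^sup>2 * frechet_derivative (\<lambda>y. frechet_derivative f (at y) u) (at (x + s *\<^sub>R u + t *\<^sub>R v)) v"
      using eq1 eq2 unfolding Du_def[symmetric] by (simp add: power2_eq_square algebra_simps)
  qed
qed

text \<open>Shrinking parallelograms at \<open>x\<close> yield pairs of points arbitrarily close to \<open>x\<close> such that one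
mixed derivative at the first point equals the other one at the second point. As both are
continuous, they agree at \<open>x\<close>.\<close>

lemma frechet_derivative_commute:
  fixes f :: "'e::euclidean_space \<Rightarrow> real"
  assumes "open S" "Ck_on 2 S f" "x \<in> S"
  shows "frechet_derivative (\<lambda>y. frechet_derivative f (at y) u) (at x) v =
    frechet_derivative (\<lambda>y. frechet_derivative f (at y) v) (at x) u"
proof (rule ccontr)
  define D where "D = (\<lambda>u v x. frechet_derivative (\<lambda>y. frechet_derivative f (at y) u) (at x) v)"
  assume "\<not> ?thesis"
  then have ne: "D u v x \<noteq> D v u x" by (simp add: D_def)
  define e where "e = \<bar>D u v x - D v u x\<bar> / 2"
  have "e > 0" using ne by (simp add: e_def)
  have cont: "isCont (D u v) x" for u v
  proof -
    have "Ck_on (Suc (Suc 0)) S f" using assms(2) by (simp only: numeral_2_eq_2)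
    then have "continuous_on S (D u v)" by (simp add: D_def)
    then show ?thesis using assms(1,3) continuous_on_eq_continuous_at by blast
  qed
  obtain d1 where d1: "d1 > 0" "\<And>y. dist y x < d1 \<Longrightarrow> dist (D u v y) (D u v x) < e"
    using cont[of u v] \<open>e > 0\<close> unfolding continuous_at_eps_delta dist_norm by blast
  obtain d2 where d2: "d2 > 0" "\<And>y. dist y x < d2 \<Longrightarrow> dist (D v u y) (D v u x) < e"
    using cont[of v u] \<open>e > 0\<close> unfolding continuous_at_eps_delta dist_norm by blast
  obtain d3 where d3: "d3 > 0" "ball x d3 \<subseteq> S" using assms(1,3) openE by blast
  define d where "d = min d1 (min d2 d3)"
  have "d > 0" using d1 d2 d3 by (simp add: d_def)
  \<comment> \<open>The parallelogram with sides \<open>h u\<close> and \<open>h v\<close> lies in the ball of radius \<open>d\<close>; the \<open>1\<close> covers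
    the case \<open>u = v = 0\<close>.\<close>
  define h where "h = d / (2 * (norm u + norm v + 1))"
  have pos: "norm u + norm v + 1 > 0" by (smt (verit) norm_ge_zero)
  have "h > 0" using \<open>d > 0\<close> pos by (simp add: h_def)
  have near: "dist (x + s *\<^sub>R u + t *\<^sub>R v) x < d" if "0 \<le> s" "s \<le> h" "0 \<le> t" "t \<le> h" for s t
  proof -
    have "dist (x + s *\<^sub>R u + t *\<^sub>R v) x = norm (s *\<^sub>R u + t *\<^sub>R v)" by (simp add: dist_norm)
    also have "\<dots> \<le> s * norm u + t * norm v" using norm_triangle_ineq[of "s *\<^sub>R u" "t *\<^sub>R v"] that by simp
    also have "\<dots> \<le> h * norm u + h * norm v" using that by (intro add_mono mult_right_mono) auto
    also have "\<dots> < h * (2 * (norm u + norm v + 1))" using \<open>h > 0\<close>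
      by (smt (verit) distrib_left mult_less_cancel_left_pos norm_ge_zero)
    also have "\<dots> = d" using pos by (simp add: h_def)
    finally show ?thesis .
  qed
  have S1: "x + s *\<^sub>R u + t *\<^sub>R v \<in> S" if "0 \<le> s" "s \<le> h" "0 \<le> t" "t \<le> h" for s t
    using near[OF that] d3 by (auto simp: d_def dist_commute subset_iff)
  have S2: "x + s *\<^sub>R v + t *\<^sub>R u \<in> S" if "0 \<le> s" "s \<le> h" "0 \<le> t" "t \<le> h" for s t
    using S1[of t s] that by (simp add: algebra_simps)
  obtain s t where st: "0 < s" "s < h" "0 < t" "t < h"
    "f (x + h *\<^sub>R u + h *\<^sub>R v) - f (x + h *\<^sub>R u) - f (x + h *\<^sub>R v) + f x = h\<^sup>2 * D u v (x + s *\<^sub>R u + t *\<^sub>R v)"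
    using second_difference_mvt[OF assms(2) \<open>h > 0\<close> S1] unfolding D_def by blast
  obtain s' t' where st': "0 < s'" "s' < h" "0 < t'" "t' < h"
    "f (x + h *\<^sub>R v + h *\<^sub>R u) - f (x + h *\<^sub>R v) - f (x + h *\<^sub>R u) + f x = h\<^sup>2 * D v u (x + s' *\<^sub>R v + t' *\<^sub>R u)"
    using second_difference_mvt[OF assms(2) \<open>h > 0\<close> S2] unfolding D_def by blast
  have "x + h *\<^sub>R v + h *\<^sub>R u = x + h *\<^sub>R u + h *\<^sub>R v" by simp
  then have "h\<^sup>2 * D u v (x + s *\<^sub>R u + t *\<^sub>R v) = h\<^sup>2 * D v u (x + s' *\<^sub>R v + t' *\<^sub>R u)"
    using st(5) st'(5) by (simp only: ac_simps diff_right_commute)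
  then have "D u v (x + s *\<^sub>R u + t *\<^sub>R v) = D v u (x + s' *\<^sub>R v + t' *\<^sub>R u)"
    using \<open>h > 0\<close> by simp
  moreover have "dist (D u v (x + s *\<^sub>R u + t *\<^sub>R v)) (D u v x) < e"
    using near[of s t] st by (intro d1(2)) (auto simp: d_def)
  moreover have "dist (D v u (x + s' *\<^sub>R v + t' *\<^sub>R u)) (D v u x) < e"
  proof (rule d2(2))
    have "dist (x + t' *\<^sub>R u + s' *\<^sub>R v) x < d2" using near[of t' s'] st' by (simp add: d_def)
    moreover have "x + s' *\<^sub>R v + t' *\<^sub>R u = x + t' *\<^sub>R u + s' *\<^sub>R v" by simp
    ultimately show "dist (x + s' *\<^sub>R v + t' *\<^sub>R u) x < d2" by metis
  qed
  ultimately show False unfolding e_def dist_real_def by argo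
qed

lemma frechet_derivative_apply_sum:
  fixes F :: "'e::euclidean_space \<Rightarrow> real"
  assumes "open S" "Ck_on 2 S F" "x \<in> S" "(w has_derivative w') (at x)"
  shows "frechet_derivative (\<lambda>y. frechet_derivative F (at y) (w y)) (at x) u =
    (\<Sum>b\<in>Basis. (w x \<bullet> b) * frechet_derivative (\<lambda>y. frechet_derivative F (at y) b) (at x) u) +
    frechet_derivative F (at x) (w' u)"
proof -
  have C: "Ck_on (Suc (Suc 0)) S F" using assms(2) by (simp only: numeral_2_eq_2)
  have lin: "linear (frechet_derivative F (at y))" if "y \<in> S" for y
    using C that by (intro linear_frechet_derivative) auto
  have d: "((\<lambda>y. frechet_derivative F (at y) b) has_derivative
      frechet_derivative (\<lambda>y. frechet_derivative F (at y) b) (at x)) (at x)" for b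
    using C assms(3) by (simp add: frechet_derivative_works)
  have "((\<lambda>y. \<Sum>b\<in>Basis. (w y \<bullet> b) * frechet_derivative F (at y) b) has_derivative
     (\<lambda>u. \<Sum>b\<in>Basis. (w x \<bullet> b) * frechet_derivative (\<lambda>y. frechet_derivative F (at y) b) (at x) u +
        (w' u \<bullet> b) * frechet_derivative F (at x) b)) (at x)"
    by (intro has_derivative_sum has_derivative_mult[OF has_derivative_inner_left[OF assms(4)] d])
  then have "((\<lambda>y. frechet_derivative F (at y) (w y)) has_derivative
     (\<lambda>u. \<Sum>b\<in>Basis. (w x \<bullet> b) * frechet_derivative (\<lambda>y. frechet_derivative F (at y) b) (at x) u +
        (w' u \<bullet> b) * frechet_derivative F (at x) b)) (at x)"
    by (rule has_derivative_transform_within_open[OF _ assms(1,3)])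
       (simp add: linear_Basis_expansion[OF lin, symmetric, simplified])
  from frechet_derivative_at[OF this, symmetric] show ?thesis
    using linear_Basis_expansion[OF lin[OF assms(3)], of "w' u"] by (simp add: sum.distrib)
qed

text \<open>The product rule for \<open>y \<mapsto> DF(y)(w y)\<close>: one term differentiates \<open>DF\<close> with the direction
frozen at \<open>w x\<close>, the other differentiates \<open>w\<close>. The first term is identified by applying the
coordinate version to a constant direction.\<close>

lemma frechet_derivative_apply:
  fixes F :: "'e::euclidean_space \<Rightarrow> real"
  assumes "open S" "Ck_on 2 S F" "x \<in> S" "(w has_derivative w') (at x)"
  shows "frechet_derivative (\<lambda>y. frechet_derivative F (at y) (w y)) (at x) u =
    frechet_derivative (\<lambda>y. frechet_derivative F (at y) (w x)) (at x) u +
    frechet_derivative F (at x) (w' u)"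
proof -
  have "linear (frechet_derivative F (at x))"
    using assms(2,3) by (intro linear_frechet_derivative) (auto simp: numeral_2_eq_2)
  then show ?thesis
    using frechet_derivative_apply_sum[OF assms, of u]
      frechet_derivative_apply_sum[OF assms(1-3) has_derivative_const, of "w x" u]
    by (simp add: linear_0)
qed

section \<open>Smooth bump functions\<close>

text \<open>The powers of \<open>t\<close> in the denominator are included so that all derivatives of \<open>exp (- 1 / t)\<close>
are linear combinations of members of the family.\<close>

definition flat_exp :: "nat \<Rightarrow> real \<Rightarrow> real" where
  "flat_exp k t = (if t > 0 then exp (- (1 / t)) / t ^ k else 0)"

text \<open>At the right of \<open>0\<close>, the substitution \<open>t = 1 / x\<close> turns the claim into the decay of
\<open>x\<^sup>k / exp x\<close>.\<close>

lemma flat_exp_tendsto_0: "(flat_exp k \<longlongrightarrow> 0) (at 0)"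
proof (rule filterlim_split_at)
  have "eventually (\<lambda>t::real. t < 0) (at_left 0)" by (simp add: eventually_at_filter)
  then have "eventually (\<lambda>t::real. flat_exp k t = 0) (at_left 0)"
    by eventually_elim (simp add: flat_exp_def)
  then show "(flat_exp k \<longlongrightarrow> 0) (at_left 0)" by (rule tendsto_eventually)
  have "eventually (\<lambda>x::real. x ^ k / exp x = flat_exp k (inverse x)) at_top"
    using eventually_gt_at_top[of 0]
    by eventually_elim (simp add: flat_exp_def exp_minus divide_inverse power_inverse mult.commute)
  then have "((\<lambda>x. flat_exp k (inverse x)) \<longlongrightarrow> 0) at_top"
    by (rule Lim_transform_eventually[OF tendsto_power_div_exp_0])
  then show "(flat_exp k \<longlongrightarrow> 0) (at_right 0)"
    by (rule filterlim_at_right_to_top[THEN iffD2])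
qed

text \<open>The family is closed under differentiation, also at \<open>0\<close>, where the difference quotient of
one member is the next member. This makes smoothness an easy induction.\<close>

lemma DERIV_flat_exp:
  "(flat_exp k has_real_derivative flat_exp (k + 2) t - real k * flat_exp (k + 1) t) (at t)"
proof (cases t "0::real" rule: linorder_cases)
  case less
  have "(flat_exp k has_real_derivative 0) (at t)"
    by (rule has_field_derivative_transform_within_open[of "\<lambda>_. 0" _ _ "{..<0}"])
       (use less in \<open>auto simp: flat_exp_def\<close>)
  then show ?thesis using less by (simp add: flat_exp_def)
next
  case equal
  have eq: "(flat_exp k (0 + h) - flat_exp k 0) / h = flat_exp (k + 1) h" for h
    by (simp add: flat_exp_def)
  have "(flat_exp k has_real_derivative 0) (at 0)"
    unfolding DERIV_def eq by (rule flat_exp_tendsto_0)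
  then show ?thesis using equal by (simp add: flat_exp_def)
next
  case greater
  have "((\<lambda>t. exp (- (1 / t)) / t ^ k) has_real_derivative
      flat_exp (k + 2) t - real k * flat_exp (k + 1) t) (at t)"
    using greater
    apply (auto intro!: derivative_eq_intros simp: flat_exp_def)
    apply (cases k)
    apply (auto simp: field_simps power2_eq_square)
    done
  then show ?thesis
    by (rule has_field_derivative_transform_within_open[of _ _ _ "{0<..}"])
       (use greater in \<open>auto simp: flat_exp_def\<close>)
qed

lemma smooth_on_flat_exp: "smooth_on UNIV (flat_exp k)"
proof -
  have "Ck_on m UNIV (flat_exp k)" for m
  proof (induction m arbitrary: k)
    case 0
    have "isCont (flat_exp k) t" for t by (rule DERIV_isCont[OF DERIV_flat_exp])
    then show ?case by (simp add: continuous_at_imp_continuous_on)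
  next
    case (Suc m)
    have lin: "Ck_on m UNIV (\<lambda>t. flat_exp j t * c)" for j c
      by (rule Ck_on_bounded_linear_comp[OF _ bounded_linear_mult_left Suc.IH]) simp
    have eq: "(flat_exp (k + 2) t - real k * flat_exp (k + 1) t) * v =
        flat_exp (k + 2) t * v + flat_exp (k + 1) t * (- real k * v)" for t v
      by (simp only: left_diff_distrib) simp
    have "Ck_on m UNIV (\<lambda>t. (flat_exp (k + 2) t - real k * flat_exp (k + 1) t) * v)" for v
      unfolding eq by (rule Ck_on_add[OF open_UNIV lin lin])
    then show ?case
      by (rule Ck_on_SucI[OF open_UNIV DERIV_flat_exp[unfolded has_field_derivative_def]])
  qed
  then show ?thesis by (simp add: smooth_on_def)
qed

lemma smooth_bump_exists:
  fixes x0 :: "'e::euclidean_space"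
  assumes "r > 0"
  obtains \<phi> :: "'e \<Rightarrow> real" where "smooth_on UNIV \<phi>" "\<phi> x0 = 1" "\<And>x. x \<notin> cball x0 r \<Longrightarrow> \<phi> x = 0"
proof
  \<comment> \<open>A bump as \<open>exp (- 1 / q)\<close>, where \<open>q\<close> is positive exactly inside the sphere of radius \<open>r\<close>.\<close>
  define q where "q = (\<lambda>x. r\<^sup>2 + - ((x + - x0) \<bullet> (x + - x0)))"
  define \<phi> where "\<phi> = (\<lambda>x. flat_exp 0 (q x) *\<^sub>R inverse (flat_exp 0 (r\<^sup>2)))"
  have id: "smooth_on UNIV (\<lambda>x::'e. x)"
    unfolding smooth_on_def
  proof
    fix k show "Ck_on k UNIV (\<lambda>x::'e. x)" by (cases k) (auto intro: Ck_on_const)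
  qed
  have "smooth_on UNIV q" unfolding q_def
    by (intro smooth_on_add smooth_on_const smooth_on_bounded_linear_comp[OF _ bounded_linear_minus[OF bounded_linear_ident]]
        smooth_on_bounded_bilinear[OF _ bounded_bilinear_inner] id open_UNIV)
  then show "smooth_on UNIV \<phi>" unfolding \<phi>_def
    by (intro smooth_on_scaleR smooth_on_const smooth_on_compose[OF _ _ _ _ smooth_on_flat_exp]) auto
  show "\<phi> x0 = 1" using assms by (simp add: \<phi>_def q_def flat_exp_def)
  show "\<phi> x = 0" if "x \<notin> cball x0 r" for x
  proof -
    have "norm (x - x0) > r" using that by (simp add: dist_norm norm_minus_commute)
    then have "(norm (x - x0))\<^sup>2 > r\<^sup>2" using assms by (intro power_strict_mono) auto
    then show ?thesis by (simp add: \<phi>_def q_def flat_exp_def power2_norm_eq_inner)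
  qed
qed

section \<open>The linear coefficient of the characteristic polynomial\<close>

text \<open>Expanding the new row, only the term with row \<open>k\<close> itself survives, since the others have two
equal rows.\<close>

lemma det_replace_row_by_combination:
  fixes A :: "'a::comm_ring_1^'n^'n"
  shows "det (\<chi> i. if i = k then \<Sum>j\<in>UNIV. y j *s A $ j else A $ i) = y k * det A"
proof -
  have rows: "det (\<chi> i. if i = k then A $ j else A $ i) = (if j = k then det A else 0)" for j
  proof (cases "j = k")
    case True
    then have "(\<chi> i. if i = k then A $ j else A $ i) = A" by (simp add: vec_eq_iff)
    then show ?thesis using True by simp
  next
    case False
    show ?thesis using False by (auto intro!: det_identical_rows[of k j] simp: row_def vec_eq_iff)
  qed
  have "det (\<chi> i. if i = k then \<Sum>j\<in>UNIV. y j *s A $ j else A $ i) =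
      (\<Sum>j\<in>UNIV. det (\<chi> i. if i = k then y j *s A $ j else A $ i))"
    by (rule det_linear_row_sum[OF finite, of k "\<lambda>i j. y j *s A $ j" UNIV "\<lambda>i. A $ i"])
  also have "\<dots> = (\<Sum>j\<in>UNIV. y j * det (\<chi> i. if i = k then A $ j else A $ i))"
    by (intro sum.cong refl det_row_mul)
  also have "\<dots> = (\<Sum>j\<in>UNIV. if j = k then y k * det A else 0)"
    by (intro sum.cong refl) (simp add: rows)
  finally show ?thesis by simp
qed

lemma poly_det:
  fixes P :: "real poly^'n^'n"
  shows "poly (det P) a = det (\<chi> i j. poly (P $ i $ j) a)"
  by (simp add: det_def poly_sum poly_prod poly_of_int)

text \<open>If \<open>y\<close> annihilates \<open>M\<close> from the left, the combination of the rows of \<open>x Id - M\<close> with weights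
\<open>y\<close> is \<open>x y\<close>. Putting it in row \<open>k\<close> multiplies the determinant by \<open>y\<^sub>k\<close>, and the factor \<open>x\<close> can be
taken out; the rest is evaluated at \<open>x = 0\<close>.\<close>

lemma coeff_1_char_poly:
  fixes M :: "real^'n^'n"
  assumes "y v* M = 0"
  shows "y $ k * coeff (char_poly M) 1 = det (\<chi> i. if i = k then y else - M $ i)"
proof -
  define N where "N = mat [:0, 1:] - (\<chi> i j. [:M $ i $ j:])"
  define P where "P = (\<chi> i. if i = k then (\<chi> j. [:y $ j:]) else N $ i)"
  have "(\<Sum>i\<in>UNIV. [:y $ i:] *s N $ i) = [:0, 1:] *s (\<chi> j. [:y $ j:])"
  proof (simp add: vec_eq_iff, intro allI)
    fix j
    have "(\<Sum>i\<in>UNIV. y $ i * M $ i $ j) = 0"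
      using assms by (simp add: vec_eq_iff vector_matrix_mult_def)
    then have "coeff (\<Sum>i\<in>UNIV. [:y $ i * M $ i $ j:]) n = 0" for n
      by (cases n) (simp_all add: coeff_sum)
    then have z: "(\<Sum>i\<in>UNIV. [:y $ i * M $ i $ j:]) = 0"
      by (simp add: poly_eq_iff)
    have "(\<Sum>i\<in>UNIV. [:y $ i:] * N $ i $ j) = (\<Sum>i\<in>UNIV. (if i = j then [:0, y $ j:] else 0) - [:y $ i * M $ i $ j:])"
      by (intro sum.cong refl) (simp add: N_def mat_def)
    also have "\<dots> = [:0, y $ j:]" by (simp add: sum_subtractf z)
    finally show "(\<Sum>i\<in>UNIV. smult (y $ i) (N $ i $ j)) = [:0, y $ j:]" by simp
  qed
  then have "[:y $ k:] * char_poly M = det (\<chi> i. if i = k then [:0, 1:] *s (\<chi> j. [:y $ j:]) else N $ i)"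
    unfolding char_poly_def N_def[symmetric]
    by (simp only: det_replace_row_by_combination[of k "\<lambda>i. [:y $ i:]" N, symmetric])
  also have "\<dots> = [:0, 1:] * det P" unfolding P_def by (rule det_row_mul)
  finally have "coeff ([:y $ k:] * char_poly M) 1 = coeff ([:0, 1:] * det P) 1" by simp
  then have "y $ k * coeff (char_poly M) 1 = poly (det P) 0"
    by (simp add: poly_0_coeff_0)
  also have "\<dots> = det (\<chi> i. if i = k then y else - M $ i)"
    unfolding poly_det
    by (intro arg_cong[of _ _ det]) (auto simp: P_def N_def vec_eq_iff mat_def)
  finally show ?thesis .
qed

text \<open>If \<open>v \<in> W\<close> is a nonzero vector of the kernel, the orthogonal complement of \<open>v\<close> in \<open>W\<close> has
smaller dimension and the same image as \<open>W\<close>.\<close>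

lemma dim_linear_image_eq_iff_trivial_kernel:
  fixes f :: "'e::euclidean_space \<Rightarrow> 'f::euclidean_space"
  assumes "linear f" "subspace W"
  shows "dim (f ` W) = dim W \<longleftrightarrow> (\<forall>v\<in>W. f v = 0 \<longrightarrow> v = 0)"
proof
  assume ker: "\<forall>v\<in>W. f v = 0 \<longrightarrow> v = 0"
  have "inj_on f W"
  proof (rule inj_onI)
    fix a b assume ab: "a \<in> W" "b \<in> W" "f a = f b"
    have "f (a - b) = 0" using ab assms(1) by (simp add: linear_diff)
    then show "a = b" using ker ab subspace_diff[OF assms(2)] by force
  qed
  then show "dim (f ` W) = dim W" using assms by (intro dim_image_eq) (auto simp: span_eq_iff[THEN iffD2])
next
  assume eq: "dim (f ` W) = dim W"
  show "\<forall>v\<in>W. f v = 0 \<longrightarrow> v = 0"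
  proof (intro ballI impI, rule ccontr)
    fix v assume v: "v \<in> W" "f v = 0" "v \<noteq> 0"
    define W' where "W' = W \<inter> {x. v \<bullet> x = 0}"
    have sub: "subspace W'" unfolding W'_def by (intro subspace_inter[OF assms(2)] subspace_hyperplane)
    have "v \<notin> W'" using v by (simp add: W'_def)
    then have "W' \<subset> W" using v(1) unfolding W'_def by blast
    then have "dim W' < dim W" using sub assms(2) by (metis dim_psubset span_eq_iff)
    moreover have "f ` W \<subseteq> f ` W'"
    proof
      fix z assume "z \<in> f ` W"
      then obtain w where w: "w \<in> W" "z = f w" by auto
      \<comment> \<open>Subtracting the component along the kernel vector \<open>v\<close> does not change the image.\<close>
      let ?w = "w - ((v \<bullet> w) / (v \<bullet> v)) *\<^sub>R v"
      have "?w \<in> W'" using v w assms(2)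
        by (auto simp: W'_def inner_diff_right subspace_diff subspace_scale)
      moreover have "f ?w = z" using v w assms(1) by (simp add: linear_diff linear_cmul)
      ultimately show "z \<in> f ` W'" by (metis imageI)
    qed
    then have "dim (f ` W) \<le> dim W'"
      using dim_image_le[OF assms(1), of W'] dim_subset order_trans by blast
    ultimately show False using eq by simp
  qed
qed

text \<open>Both sides express that the kernel of \<open>M\<close> meets the hyperplane orthogonal to \<open>y\<close> only in
\<open>0\<close>. As \<open>x0\<close> is in the kernel and not in the hyperplane, the hyperplane has the full image of \<open>M\<close>;
and the determinant that computes the coefficient belongs to a matrix with exactly this kernel,
because \<open>y v* M = 0\<close> makes row \<open>k\<close> of \<open>M\<close> a combination of the others when \<open>y\<^sub>k \<noteq> 0\<close>.\<close>

lemma rank_eq_iff_coeff_1_char_poly: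
  fixes M :: "real^'n^'n"
  assumes "M *v x0 = 0" "y v* M = 0" "y \<bullet> x0 \<noteq> 0"
  shows "rank M = CARD('n) - 1 \<longleftrightarrow> coeff (char_poly M) 1 \<noteq> 0"
proof -
  define W where "W = {v. y \<bullet> v = 0}"
  have subW: "subspace W" unfolding W_def by (rule subspace_hyperplane)
  have "y \<noteq> 0" using assms(3) by auto
  then have dimW: "dim W = CARD('n) - 1" unfolding W_def by (simp add: dim_hyperplane)
  obtain k where k: "y $ k \<noteq> 0" using \<open>y \<noteq> 0\<close> by (auto simp: vec_eq_iff)
  define B where "B = (\<chi> i. if i = k then y else - M $ i)"
  have "range ((*v) M) \<subseteq> (*v) M ` W"
  proof
    fix z assume "z \<in> range ((*v) M)"
    then obtain v where v: "z = M *v v" by auto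
    \<comment> \<open>The projection of \<open>v\<close> to the hyperplane along \<open>x0\<close>.\<close>
    let ?w = "v - ((y \<bullet> v) / (y \<bullet> x0)) *\<^sub>R x0"
    have "?w \<in> W" using assms(3) by (simp add: W_def inner_diff_right)
    moreover have "M *v ?w = z"
      by (simp add: v matrix_vector_mult_diff_distrib matrix_vector_mult_scaleR assms(1))
    ultimately show "z \<in> (*v) M ` W" by (metis imageI)
  qed
  then have "range ((*v) M) = (*v) M ` W" by auto
  then have rk: "rank M = CARD('n) - 1 \<longleftrightarrow> (\<forall>v\<in>W. M *v v = 0 \<longrightarrow> v = 0)"
    using dim_linear_image_eq_iff_trivial_kernel[OF matrix_vector_mul_linear subW, of M]
    by (simp add: rank_dim_range dimW)
  have ker: "B *v v = 0 \<longleftrightarrow> v \<in> W \<and> M *v v = 0" for v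
  proof -
    have comp: "(B *v v) $ i = (if i = k then y \<bullet> v else - (M *v v) $ i)" for i
      by (auto simp: B_def matrix_vector_mult_def inner_vec_def sum_negf)
    have "y \<bullet> (M *v v) = 0" using assms(2) by (simp add: dot_lmul_matrix[symmetric])
    then have "(M *v v) $ k = 0" if "\<And>i. i \<noteq> k \<Longrightarrow> (M *v v) $ i = 0"
    proof -
      have "y \<bullet> (M *v v) = (\<Sum>i\<in>UNIV. if i = k then y $ k * (M *v v) $ k else 0)"
        unfolding inner_vec_def by (intro sum.cong refl) (use that in auto)
      then show ?thesis using \<open>y \<bullet> (M *v v) = 0\<close> k by simp
    qed
    then show ?thesis unfolding vec_eq_iff comp W_def by auto
  qed
  have "coeff (char_poly M) 1 \<noteq> 0 \<longleftrightarrow> det B \<noteq> 0"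
    using coeff_1_char_poly[OF assms(2), of k] k by (metis B_def mult_eq_0_iff)
  also have "\<dots> \<longleftrightarrow> (\<forall>v. B *v v = 0 \<longrightarrow> v = 0)"
    using matrix_left_invertible_ker[of B] by (simp add: invertible_det_nz[symmetric] invertible_left_inverse)
  finally show ?thesis using rk ker by auto
qed

text \<open>Coordinates with respect to \<open>b\<close> identify \<open>V\<close> with \<open>real^n\<close>, \<open>J\<close> with its matrix and \<open>\<phi>\<close> with
a covector. The hypotheses only concern \<open>V\<close> because the Jacobi operator has no meaning outside the
tangent space.\<close>

lemma dim_image_eq_iff_coeff_1_char_poly:
  fixes b :: "'n::finite \<Rightarrow> 'v::real_vector" and J :: "'v \<Rightarrow> 'v" and \<phi> :: "'v \<Rightarrow> real"
  assumes basis: "is_basis V b"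
    and J_in: "\<And>v. v \<in> V \<Longrightarrow> J v \<in> V"
    and J_lin: "\<And>u v a c. u \<in> V \<Longrightarrow> v \<in> V \<Longrightarrow> J (a *\<^sub>R u + c *\<^sub>R v) = a *\<^sub>R J u + c *\<^sub>R J v"
    and \<phi>_lin: "\<And>u v a c. u \<in> V \<Longrightarrow> v \<in> V \<Longrightarrow> \<phi> (a *\<^sub>R u + c *\<^sub>R v) = a * \<phi> u + c * \<phi> v"
    and \<phi>J: "\<And>v. v \<in> V \<Longrightarrow> \<phi> (J v) = 0"
    and w: "w \<in> V" "J w = 0" "\<phi> w \<noteq> 0"
  shows "dim (J ` V) = CARD('n) - 1 \<longleftrightarrow> coeff (char_poly (endo_matrix b J)) 1 \<noteq> 0"
proof -
  have b: "inj b" "independent (range b)" "span (range b) = V"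
    using basis by (auto simp: is_basis_def)
  define \<iota> where "\<iota> = (\<lambda>x::real^'n. \<Sum>i\<in>UNIV. x $ i *\<^sub>R b i)"
  define M where "M = endo_matrix b J"
  have lin: "linear \<iota>"
    by (rule linearI) (auto simp: \<iota>_def scaleR_add_left sum.distrib scaleR_sum_right)
  have \<iota>_axis: "\<iota> (axis j 1) = b j" for j
    by (simp add: \<iota>_def axis_def if_distrib[of "\<lambda>c. c *\<^sub>R _"] cong: if_cong)
  have \<iota>_rep: "\<iota> (\<chi> i. representation (range b) v (b i)) = v" if "v \<in> V" for v
    using sum_representation_eq[OF b(2), of v "range b"] that b
    by (simp add: \<iota>_def sum.reindex)
  have \<iota>_in: "\<iota> x \<in> V" for x
    unfolding \<iota>_def b(3)[symmetric] by (intro span_sum span_scale span_base) auto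
  have range: "range \<iota> = V" using \<iota>_rep \<iota>_in by (metis image_subset_iff subsetI subset_antisym rangeI)
  have "inj \<iota>"
  proof (rule linear_injective_0[OF lin, THEN iffD2], intro allI impI)
    fix x assume "\<iota> x = 0"
    then have 0: "(\<Sum>v\<in>range b. x $ (inv b v) *\<^sub>R v) = 0"
      by (simp add: \<iota>_def sum.reindex[OF b(1)] inv_f_f[OF b(1)])
    have "x $ inv b v = 0" if "v \<in> range b" for v
      using independentD[OF b(2) _ subset_refl 0 that] by simp
    then show "x = 0" using b(1) by (auto simp: vec_eq_iff) (metis inv_f_f rangeI)
  qed
  have linJ: "linear (\<lambda>x. J (\<iota> x))"
    using J_lin[OF \<iota>_in \<iota>_in, of 1 _ 1] J_lin[OF \<iota>_in \<iota>_in, of _ _ 0]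
    by (intro linearI) (auto simp: linear_add[OF lin] linear_cmul[OF lin])
  have lin\<phi>: "linear (\<lambda>x. \<phi> (\<iota> x))"
    using \<phi>_lin[OF \<iota>_in \<iota>_in, of 1 _ 1] \<phi>_lin[OF \<iota>_in \<iota>_in, of _ _ 0]
    by (intro linearI) (auto simp: linear_add[OF lin] linear_cmul[OF lin])
  have expand: "L x = (\<Sum>j\<in>UNIV. x $ j *\<^sub>R L (axis j 1))" if "linear L" for L :: "real^'n \<Rightarrow> 'x::real_vector" and x
  proof -
    have "L x = L (\<Sum>j\<in>UNIV. x $ j *\<^sub>R axis j 1)" using basis_expansion[of x] by (simp add: scalar_mult_eq_scaleR)
    then show ?thesis using that by (simp add: linear_sum linear_cmul)
  qed
  have J\<iota>: "J (\<iota> x) = \<iota> (M *v x)" for x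
  proof -
    have "J (b j) = \<iota> (M *v axis j 1)" for j
    proof -
      have "b j \<in> V" using \<iota>_in[of "axis j 1"] by (simp add: \<iota>_axis)
      then have "J (b j) = \<iota> (\<chi> i. representation (range b) (J (b j)) (b i))"
        using \<iota>_rep J_in by metis
      also have "(\<chi> i. representation (range b) (J (b j)) (b i)) = M *v axis j 1"
        by (simp add: M_def endo_matrix_def matrix_vector_mult_basis column_def)
      finally show ?thesis .
    qed
    then show ?thesis
      using expand[OF linJ, of x] expand[OF linear_compose[OF matrix_vector_mul_linear lin], of M x]
      by (simp add: \<iota>_axis o_def)
  qed
  have img: "J ` V = \<iota> ` range ((*v) M)"
    unfolding range[symmetric] image_image J\<iota> ..
  have "dim (J ` V) = rank M"
    unfolding img rank_dim_range using \<open>inj \<iota>\<close>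
    by (intro dim_image_eq lin) (auto intro: inj_on_subset)
  moreover
  obtain x0 where x0: "w = \<iota> x0" using w(1) range by auto
  define y where "y = (\<chi> i. \<phi> (\<iota> (axis i 1)))"
  have \<phi>\<iota>: "\<phi> (\<iota> x) = y \<bullet> x" for x
    using expand[OF lin\<phi>, of x] by (simp add: y_def inner_vec_def mult.commute)
  have "M *v x0 = 0"
    using w(2) \<open>inj \<iota>\<close> linear_0[OF lin] unfolding x0 J\<iota> by (metis injD)
  moreover have "y v* M = 0"
  proof -
    have "(y v* M) \<bullet> x = 0" for x
      unfolding dot_lmul_matrix using \<phi>J[OF \<iota>_in, of x] by (simp add: J\<iota> \<phi>\<iota>)
    then show ?thesis by (metis inner_eq_zero_iff)
  qed
  moreover have "y \<bullet> x0 \<noteq> 0" using w(3) by (simp add: x0 \<phi>\<iota>)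
  ultimately show ?thesis using rank_eq_iff_coeff_1_char_poly[of M x0 y] by (simp add: M_def)
qed

section \<open>Charts, tangent vectors, and global extension of local objects\<close>

definition tangent_at ::
  "('a, 'n::finite) chart set \<Rightarrow> ('a, 'n) chart \<Rightarrow> 'a \<Rightarrow> real^'n \<Rightarrow> ('a, 'n) tangent" where
  "tangent_at A c p u = (\<lambda>c'.
     if c' \<in> charts_at A p then frechet_derivative (transition c c') (at (snd c p)) u else 0)"

context
  fixes T :: "'a topology" and A :: "('a, 'n::finite) chart set"
  assumes mfd: "smooth_manifold T A"
begin

lemma chart_homeomorphic:
  "c \<in> A \<Longrightarrow> homeomorphic_map (subtopology T (fst c)) (top_of_set (snd c ` fst c)) (snd c)"
  using mfd by (auto simp: smooth_manifold_def)

lemma openin_chart_domain: "c \<in> A \<Longrightarrow> openin T (fst c)"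
  using mfd by (auto simp: smooth_manifold_def)

lemma open_chart_range: "c \<in> A \<Longrightarrow> open (snd c ` fst c)"
  using mfd by (auto simp: smooth_manifold_def)

lemma topspace_chart_domain: "c \<in> A \<Longrightarrow> topspace (subtopology T (fst c)) = fst c"
  using openin_chart_domain openin_subset by (metis topspace_subtopology_subset)

lemma inj_on_chart: "c \<in> A \<Longrightarrow> inj_on (snd c) (fst c)"
  using homeomorphic_imp_injective_map[OF chart_homeomorphic] topspace_chart_domain by metis

lemma chart_inv_chart: "c \<in> A \<Longrightarrow> p \<in> fst c \<Longrightarrow> chart_inv c (snd c p) = p"
  using inj_on_chart by (simp add: chart_inv_def)

lemma chart_inv_in: "x \<in> snd c ` U \<Longrightarrow> U \<subseteq> fst c \<Longrightarrow> c \<in> A \<Longrightarrow> chart_inv c x \<in> U"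
  by (erule imageE) (simp add: chart_inv_chart subset_iff)

lemma chart_chart_inv: "x \<in> snd c ` fst c \<Longrightarrow> snd c (chart_inv c x) = x"
  by (simp add: chart_inv_def f_inv_into_f)

lemma open_chart_image:
  assumes "c \<in> A" "openin T U" "U \<subseteq> fst c"
  shows "open (snd c ` U)"
proof -
  have "openin (subtopology T (fst c)) U"
    using assms by (metis openin_subset_topspace_eq openin_subtopology_alt openin_open_subtopology openin_chart_domain)
  then have "openin (top_of_set (snd c ` fst c)) (snd c ` U)"
    using homeomorphic_imp_open_map[OF chart_homeomorphic[OF assms(1)]] by (auto simp: open_map_def)
  then show ?thesis using open_chart_range[OF assms(1)] openin_open_eq by blast
qed

lemma open_overlap: "c \<in> A \<Longrightarrow> c' \<in> A \<Longrightarrow> open (snd c ` (fst c \<inter> fst c'))"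
  by (intro open_chart_image openin_Int openin_chart_domain) auto

text \<open>This is where the Hausdorff property enters: a set that is compact in a chart is closed in the
whole manifold, so that what vanishes outside it extends smoothly by zero.\<close>

lemma closedin_chart_inv_compact:
  assumes "c \<in> A" "compact K" "K \<subseteq> snd c ` fst c"
  shows "closedin T (chart_inv c ` K)"
proof -
  obtain g where g: "homeomorphic_maps (subtopology T (fst c)) (top_of_set (snd c ` fst c)) (snd c) g"
    using chart_homeomorphic[OF assms(1)] homeomorphic_map_maps by blast
  have "compactin (top_of_set (snd c ` fst c)) K"
    using assms(2,3) by (simp add: compactin_subtopology)
  then have "compactin (subtopology T (fst c)) (g ` K)"
    by (rule image_compactin) (use g in \<open>unfold homeomorphic_maps_def, blast\<close>)
  moreover have "g ` K = chart_inv c ` K"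
  proof (rule image_cong[OF refl])
    fix x assume "x \<in> K"
    then obtain q where q: "q \<in> fst c" "x = snd c q" using assms(3) by auto
    then show "g x = chart_inv c x"
      using g topspace_chart_domain[OF assms(1)] chart_inv_chart[OF assms(1)]
      by (simp add: homeomorphic_maps_def)
  qed
  ultimately have "compactin T (chart_inv c ` K)" by (simp add: compactin_subtopology)
  then show ?thesis using mfd compactin_imp_closedin by (auto simp: smooth_manifold_def)
qed

lemma transition_apply: "c \<in> A \<Longrightarrow> q \<in> fst c \<Longrightarrow> transition c c' (snd c q) = snd c' q"
  by (simp add: transition_def chart_inv_chart)

lemma smooth_on_transition:
  "c \<in> A \<Longrightarrow> c' \<in> A \<Longrightarrow> smooth_on (snd c ` (fst c \<inter> fst c')) (transition c c')"
  using mfd by (auto simp: smooth_manifold_def)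

lemma transition_has_derivative:
  assumes "c \<in> charts_at A p" "c' \<in> charts_at A p"
  shows "(transition c c' has_derivative frechet_derivative (transition c c') (at (snd c p))) (at (snd c p))"
  using assms by (intro smooth_on_has_derivative[OF smooth_on_transition]) (auto simp: charts_at_def)

lemma linear_transition_derivative:
  assumes "c \<in> charts_at A p" "c' \<in> charts_at A p"
  shows "linear (frechet_derivative (transition c c') (at (snd c p)))"
  by (rule has_derivative_linear[OF transition_has_derivative[OF assms]])

text \<open>The chain rule for a change of charts, for maps \<open>h\<close> on the manifold with values in any
normed space: \<open>h\<close> may be a function or the coordinate map of a third chart.\<close>

lemma frechet_derivative_via_transition:
  assumes c: "c \<in> charts_at A p" and c': "c' \<in> charts_at A p"
    and h: "(h \<circ> chart_inv c') differentiable (at (snd c' p))"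
  shows "frechet_derivative (h \<circ> chart_inv c) (at (snd c p)) u =
    frechet_derivative (h \<circ> chart_inv c') (at (snd c' p)) (frechet_derivative (transition c c') (at (snd c p)) u)"
proof -
  have cA: "c \<in> A" "c' \<in> A" "p \<in> fst c" "p \<in> fst c'" using c c' by (auto simp: charts_at_def)
  have "(h \<circ> chart_inv c' has_derivative frechet_derivative (h \<circ> chart_inv c') (at (snd c' p)))
      (at (transition c c' (snd c p)))"
    using h cA by (simp add: transition_apply frechet_derivative_works)
  from has_derivative_compose[OF transition_has_derivative[OF c c'] this]
  have "(h \<circ> chart_inv c has_derivative (\<lambda>u. frechet_derivative (h \<circ> chart_inv c') (at (snd c' p))
      (frechet_derivative (transition c c') (at (snd c p)) u))) (at (snd c p))"
    by (rule has_derivative_transform_within_open[OF _ open_overlap[OF cA(1,2)]])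
       (use cA in \<open>auto simp: transition_apply chart_inv_chart\<close>)
  from fun_cong[OF frechet_derivative_at[OF this], symmetric] show ?thesis .
qed

text \<open>This makes the coordinate vectors \<open>tangent_at A c p u\<close> compatible with each other.\<close>

lemma transition_derivative_cocycle:
  assumes "c \<in> charts_at A p" "c' \<in> charts_at A p" "c'' \<in> charts_at A p"
  shows "frechet_derivative (transition c' c'') (at (snd c' p))
      (frechet_derivative (transition c c') (at (snd c p)) u) =
    frechet_derivative (transition c c'') (at (snd c p)) u"
  unfolding transition_def[of _ c'']
  using transition_has_derivative[OF assms(2,3)]
  by (intro frechet_derivative_via_transition[OF assms(1,2), symmetric])
     (auto simp: transition_def differentiable_def)

lemma transition_derivative_self:
  assumes "c \<in> charts_at A p"
  shows "frechet_derivative (transition c c) (at (snd c p)) u = u"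
proof -
  have cA: "c \<in> A" "p \<in> fst c" using assms by (auto simp: charts_at_def)
  have "(transition c c has_derivative (\<lambda>u. u)) (at (snd c p))"
    by (rule has_derivative_transform_within_open[OF has_derivative_ident open_chart_range[OF cA(1)]])
       (use cA in \<open>auto simp: transition_apply\<close>)
  from fun_cong[OF frechet_derivative_at[OF this], symmetric] show ?thesis .
qed

lemma tangent_space_transition:
  assumes "v \<in> tangent_space A p" "c \<in> charts_at A p" "c' \<in> charts_at A p"
  shows "frechet_derivative (transition c c') (at (snd c p)) (v c) = v c'"
proof -
  have "v c' = frechet_derivative (transition c c') (at (snd c p)) (v c)"
    using assms unfolding tangent_space_def by blast
  then show ?thesis by (rule sym)
qed

lemma tangent_space_off_chart: "v \<in> tangent_space A p \<Longrightarrow> c \<notin> charts_at A p \<Longrightarrow> v c = 0"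
  unfolding tangent_space_def by blast

lemma tangent_at_in: "c \<in> charts_at A p \<Longrightarrow> tangent_at A c p u \<in> tangent_space A p"
  by (auto simp: tangent_space_def tangent_at_def transition_derivative_cocycle)

lemma tangent_at_self: "c \<in> charts_at A p \<Longrightarrow> tangent_at A c p u c = u"
  by (simp add: tangent_at_def transition_derivative_self)

lemma tangent_at_coords: "c \<in> charts_at A p \<Longrightarrow> v \<in> tangent_space A p \<Longrightarrow> tangent_at A c p (v c) = v"
  by (rule ext) (simp add: tangent_at_def tangent_space_off_chart tangent_space_transition)

lemma linear_tangent_at: "c \<in> charts_at A p \<Longrightarrow> linear (tangent_at A c p)"
  by (rule linearI)
     (simp_all add: tangent_at_def fun_eq_iff scaleR_fun_def
        linear_add[OF linear_transition_derivative] linear_cmul[OF linear_transition_derivative])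

lemma range_tangent_at: "c \<in> charts_at A p \<Longrightarrow> range (tangent_at A c p) = tangent_space A p"
  by (intro equalityI subsetI)
     (auto intro: tangent_at_in intro: range_eqI[where f = "tangent_at A c p", OF tangent_at_coords[symmetric]])

lemma tangent_space_off_charts: "charts_at A p = {} \<Longrightarrow> tangent_space A p = {0}"
  by (auto simp: tangent_space_def fun_eq_iff)

lemma subspace_tangent_space: "subspace (tangent_space A p)"
proof (cases "charts_at A p = {}")
  case True
  then show ?thesis by (simp add: tangent_space_off_charts subspace_single_0)
next
  case False
  then obtain c where c: "c \<in> charts_at A p" by auto
  from linear_subspace_image[OF linear_tangent_at[OF c] subspace_UNIV] show ?thesis
    by (simp only: range_tangent_at[OF c])
qed

text \<open>Reading off coordinates in the chart \<open>c\<close> identifies the tangent space with \<open>real^n\<close>.\<close>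

lemma basis_tangent_space:
  assumes "c \<in> charts_at A p"
  shows "is_basis (tangent_space A p) (\<lambda>i. tangent_at A c p (axis i 1))"
proof -
  let ?t = "tangent_at A c p" and ?e = "\<lambda>i::'n. axis i (1::real)"
  note lin = linear_tangent_at[OF assms]
  have inj: "inj ?t" by (rule inj_on_inverseI[of _ "\<lambda>v. v c"]) (rule tangent_at_self[OF assms])
  have Basis: "range ?e = (Basis :: (real^'n) set)" by (auto simp: Basis_vec_def)
  have rng: "range (\<lambda>i. ?t (?e i)) = ?t ` Basis" by (simp add: Basis[symmetric] image_image)
  have "inj (\<lambda>i. ?t (?e i))" using inj by (intro injI) (metis axis_eq_axis injD zero_neq_one)
  moreover have "independent (?t ` Basis)"
    using inj by (intro linear_independent_injective_image[OF lin independent_Basis]) (auto intro: inj_on_subset)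
  moreover have "span (?t ` Basis) = tangent_space A p"
    by (simp add: linear_span_image[OF lin] range_tangent_at[OF assms])
  ultimately show ?thesis by (simp add: is_basis_def rng)
qed

lemma vector_field_tangent: "X \<in> vector_fields A \<Longrightarrow> X p \<in> tangent_space A p"
  by (simp add: vector_fields_def)

lemma vector_fields_lincomb:
  assumes f: "f \<in> smooth_functions A" and h: "h \<in> smooth_functions A"
    and X: "X \<in> vector_fields A" and Y: "Y \<in> vector_fields A"
  shows "(\<lambda>p. f p *\<^sub>R X p + h p *\<^sub>R Y p) \<in> vector_fields A"
proof -
  have "smooth_on (snd c ` fst c) (vf_coords (\<lambda>p. f p *\<^sub>R X p + h p *\<^sub>R Y p) c)" if "c \<in> A" for c
  proof (rule smooth_on_cong[OF open_chart_range[OF that]])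
    show "smooth_on (snd c ` fst c)
       (\<lambda>x. (f \<circ> chart_inv c) x *\<^sub>R vf_coords X c x + (h \<circ> chart_inv c) x *\<^sub>R vf_coords Y c x)"
      using assms that
      by (intro smooth_on_add smooth_on_scaleR open_chart_range) (auto simp: smooth_functions_def vector_fields_def o_def)
  qed (simp add: vf_coords_def scaleR_fun_def)
  moreover have "f p *\<^sub>R X p + h p *\<^sub>R Y p \<in> tangent_space A p" for p
    using X Y subspace_tangent_space by (intro subspace_add subspace_scale vector_field_tangent) auto
  ultimately show ?thesis by (simp add: vector_fields_def)
qed

lemma smooth_functions_const: "(\<lambda>p. a) \<in> smooth_functions A"
  by (simp add: smooth_functions_def o_def smooth_on_const)

lemma smooth_functions_mult:
  assumes "f \<in> smooth_functions A" "h \<in> smooth_functions A"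
  shows "(\<lambda>p. f p * h p) \<in> smooth_functions A"
proof -
  have "smooth_on (snd c ` fst c) (\<lambda>x. (f \<circ> chart_inv c) x * (h \<circ> chart_inv c) x)" if "c \<in> A" for c
    using assms that
    by (intro smooth_on_bounded_bilinear[OF _ bounded_bilinear_mult] open_chart_range)
       (auto simp: smooth_functions_def o_def)
  then show ?thesis by (simp add: smooth_functions_def o_def)
qed

lemma vector_fields_scale:
  assumes "f \<in> smooth_functions A" "X \<in> vector_fields A"
  shows "(\<lambda>p. f p *\<^sub>R X p) \<in> vector_fields A"
  using vector_fields_lincomb[OF assms(1) smooth_functions_const[of 0] assms(2,2)] by simp

lemma vector_fields_add: "X \<in> vector_fields A \<Longrightarrow> Y \<in> vector_fields A \<Longrightarrow> X + Y \<in> vector_fields A"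
  using vector_fields_lincomb[OF smooth_functions_const[of 1] smooth_functions_const[of 1]]
  by (simp add: plus_fun_def)

lemma vector_fields_diff: "X \<in> vector_fields A \<Longrightarrow> Y \<in> vector_fields A \<Longrightarrow> X - Y \<in> vector_fields A"
  using vector_fields_lincomb[OF smooth_functions_const[of 1] smooth_functions_const[of "-1"]]
  by (simp add: fun_diff_def)

lemma vector_fields_zero: "0 \<in> vector_fields A"
  using subspace_tangent_space subspace_0
  by (auto simp: vector_fields_def vf_coords_def smooth_on_const)

text \<open>An object given by \<open>G\<close> in the chart \<open>c\<close> and supported in a compact subset \<open>K\<close> of that chart
is smooth in every other chart \<open>c'\<close> when extended by zero. The domain of \<open>c'\<close> is covered by two
open sets: the overlap with \<open>c\<close>, where a transition map is composed with \<open>G\<close>, and the complement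
of \<open>K\<close>, where the extension is zero.\<close>

lemma smooth_on_extend_by_zero:
  assumes c: "c \<in> A" and c': "c' \<in> A"
    and K: "compact K" "K \<subseteq> snd c ` fst c"
    and G: "smooth_on (snd c ` (fst c \<inter> fst c')) G"
    and G0: "\<And>x. x \<in> snd c ` (fst c \<inter> fst c') \<Longrightarrow> x \<notin> K \<Longrightarrow> G x = 0"
  shows "smooth_on (snd c' ` fst c') (\<lambda>x. if chart_inv c' x \<in> fst c then G (transition c' c x) else 0)"
proof -
  let ?H = "\<lambda>x. if chart_inv c' x \<in> fst c then G (transition c' c x) else 0"
  define W where "W = topspace T - chart_inv c ` K"
  have "openin T W" using closedin_chart_inv_compact[OF c K] by (simp add: W_def closedin_def)
  then have open2: "open (snd c' ` (fst c' \<inter> W))"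
    by (intro open_chart_image[OF c'] openin_Int openin_chart_domain c') auto
  note open1 = open_overlap[OF c' c]
  have tr: "transition c' c ` snd c' ` (fst c' \<inter> fst c) \<subseteq> snd c ` (fst c \<inter> fst c')"
    using c' by (auto simp: transition_apply)
  have "smooth_on (snd c' ` (fst c' \<inter> fst c)) (\<lambda>x. G (transition c' c x))"
    by (rule smooth_on_compose[OF open1 open_overlap[OF c c'] tr smooth_on_transition[OF c' c] G])
  then have 1: "smooth_on (snd c' ` (fst c' \<inter> fst c)) ?H"
    by (rule smooth_on_cong[OF open1, rotated]) (use c' in \<open>auto simp: chart_inv_chart\<close>)
  have 2: "smooth_on (snd c' ` (fst c' \<inter> W)) ?H"
  proof (rule smooth_on_cong[OF open2 _ smooth_on_const[of _ 0]])
    fix x assume "x \<in> snd c' ` (fst c' \<inter> W)"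
    then obtain q where q: "q \<in> fst c'" "q \<in> W" "x = snd c' q" by auto
    have "G (snd c q) = 0" if "q \<in> fst c"
    proof (rule G0)
      show "snd c q \<notin> K" using q(2) that c by (auto simp: W_def) (metis chart_inv_chart imageI)
    qed (use q that in auto)
    then show "0 = ?H x" using q c' by (auto simp: chart_inv_chart transition_apply)
  qed
  have "fst c' \<subseteq> topspace T" using openin_chart_domain[OF c'] by (rule openin_subset)
  moreover have "chart_inv c ` K \<subseteq> fst c" using K(2) chart_inv_in[OF _ subset_refl c] by auto
  ultimately have "fst c' = (fst c' \<inter> fst c) \<union> (fst c' \<inter> W)" by (auto simp: W_def)
  then have "snd c' ` fst c' = snd c' ` (fst c' \<inter> fst c) \<union> snd c' ` (fst c' \<inter> W)"
    by (metis image_Un)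
  then show ?thesis using smooth_on_Un[OF open1 open2 1 2] by simp
qed

lemma bump_in_chart:
  assumes "c \<in> charts_at A p"
  obtains \<phi> K where "smooth_on UNIV \<phi>" "\<phi> (snd c p) = (1::real)" "compact K" "K \<subseteq> snd c ` fst c"
    "\<And>x. x \<notin> K \<Longrightarrow> \<phi> x = 0"
proof -
  obtain r where "r > 0" "cball (snd c p) r \<subseteq> snd c ` fst c"
    using assms open_chart_range[of c] by (auto simp: charts_at_def open_contains_cball)
  moreover obtain \<phi> :: "real^'n \<Rightarrow> real" where "smooth_on UNIV \<phi>" "\<phi> (snd c p) = 1"
    "\<And>x. x \<notin> cball (snd c p) r \<Longrightarrow> \<phi> x = 0"
    using smooth_bump_exists[OF \<open>r > 0\<close>] by blast
  ultimately show thesis using that compact_cball by blast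
qed

lemma smooth_functions_cutoff:
  assumes c: "c \<in> A" and K: "compact K" "K \<subseteq> snd c ` fst c"
    and \<phi>: "smooth_on UNIV \<phi>" "\<And>x. x \<notin> K \<Longrightarrow> \<phi> x = 0" and F: "smooth_on (snd c ` fst c) F"
  shows "(\<lambda>q. if q \<in> fst c then \<phi> (snd c q) * F (snd c q) else 0) \<in> smooth_functions A"
proof -
  have "smooth_on (snd c' ` fst c')
      ((\<lambda>q. if q \<in> fst c then \<phi> (snd c q) * F (snd c q) else 0) \<circ> chart_inv c')" if c': "c' \<in> A" for c'
  proof (rule smooth_on_cong[OF open_chart_range[OF c']])
    show "smooth_on (snd c' ` fst c')
       (\<lambda>x. if chart_inv c' x \<in> fst c then (\<lambda>y. \<phi> y * F y) (transition c' c x) else 0)"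
      by (rule smooth_on_extend_by_zero[OF c c' K])
         (auto intro!: smooth_on_bounded_bilinear[OF _ bounded_bilinear_mult] open_overlap c c'
           intro: smooth_on_subset[OF \<phi>(1)] smooth_on_subset[OF F] simp: \<phi>(2))
  qed (simp add: transition_def)
  then show ?thesis by (simp add: smooth_functions_def)
qed

text \<open>In another chart \<open>c'\<close>, the coordinates of the field are obtained by applying the derivative
of the transition map to \<open>\<phi> F\<close>, which is a smooth expression in the coordinates of \<open>c\<close>.\<close>

lemma vector_fields_cutoff:
  assumes c: "c \<in> A" and K: "compact K" "K \<subseteq> snd c ` fst c"
    and \<phi>: "smooth_on UNIV \<phi>" "\<And>x. x \<notin> K \<Longrightarrow> \<phi> x = 0" and F: "smooth_on (snd c ` fst c) F"
  shows "(\<lambda>q. if q \<in> fst c then tangent_at A c q (\<phi> (snd c q) *\<^sub>R F (snd c q)) else 0) \<in> vector_fields A"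
    (is "?X \<in> _")
proof -
  have "?X q \<in> tangent_space A q" for q
    using c subspace_0[OF subspace_tangent_space] by (auto intro!: tangent_at_in simp: charts_at_def)
  moreover have "smooth_on (snd c' ` fst c') (vf_coords ?X c')" if c': "c' \<in> A" for c'
  proof (rule smooth_on_cong[OF open_chart_range[OF c']])
    let ?G = "\<lambda>y. frechet_derivative (transition c c') (at y) (\<phi> y *\<^sub>R F y)"
    show "smooth_on (snd c' ` fst c') (\<lambda>x. if chart_inv c' x \<in> fst c then ?G (transition c' c x) else 0)"
    proof (rule smooth_on_extend_by_zero[OF c c' K])
      show "smooth_on (snd c ` (fst c \<inter> fst c')) ?G"
        by (intro smooth_on_apply_derivative smooth_on_transition c c' open_overlap smooth_on_scaleR
            smooth_on_subset[OF \<phi>(1)] smooth_on_subset[OF F]) auto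
      fix x assume "x \<in> snd c ` (fst c \<inter> fst c')" "x \<notin> K"
      then show "?G x = 0"
        using c c' linear_0[OF linear_transition_derivative[of c _ c']] by (auto simp: \<phi>(2) charts_at_def)
    qed
    fix x assume "x \<in> snd c' ` fst c'"
    then show "(if chart_inv c' x \<in> fst c then ?G (transition c' c x) else 0) = vf_coords ?X c' x"
      using c' by (auto simp: vf_coords_def tangent_at_def transition_def charts_at_def chart_inv_chart)
  qed
  ultimately show ?thesis by (simp add: vector_fields_def)
qed

text \<open>Take constant coordinates in a chart and cut them off by a bump function that is \<open>1\<close> at
\<open>p\<close>.\<close>

lemma vector_field_through:
  assumes c: "c \<in> charts_at A p" and v: "v \<in> tangent_space A p"
  obtains X where "X \<in> vector_fields A" "X p = v"
proof -
  obtain \<phi> K where b: "smooth_on UNIV \<phi>" "\<phi> (snd c p) = (1::real)" "compact K" "K \<subseteq> snd c ` fst c"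
    "\<And>x. x \<notin> K \<Longrightarrow> \<phi> x = 0" using bump_in_chart[OF c] by blast
  have cA: "c \<in> A" "p \<in> fst c" using c by (auto simp: charts_at_def)
  show thesis
    by (rule that[OF vector_fields_cutoff[OF cA(1) b(3,4,1,5) smooth_on_const[of _ "v c"]]])
       (simp_all add: cA b tangent_at_coords[OF c v])
qed

text \<open>The tangent vector transforms by the derivative of the transition map, the differential of
\<open>f\<close> by its inverse; so the chart chosen in the definition of \<open>dir_deriv\<close> is immaterial.\<close>

lemma dir_deriv_chart:
  assumes f: "f \<in> smooth_functions A" and v: "v \<in> tangent_space A p" and c: "c \<in> charts_at A p"
  shows "dir_deriv A p v f = frechet_derivative (f \<circ> chart_inv c) (at (snd c p)) (v c)"
proof -
  define c0 where "c0 = (SOME c. c \<in> charts_at A p)"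
  have c0: "c0 \<in> charts_at A p" unfolding c0_def using c by (rule someI)
  have "(f \<circ> chart_inv c0) differentiable (at (snd c0 p))"
    using f c0 smooth_on_has_derivative[of "snd c0 ` fst c0" "f \<circ> chart_inv c0" "snd c0 p"]
    by (auto simp: smooth_functions_def charts_at_def differentiable_def)
  from frechet_derivative_via_transition[OF c c0 this, of "v c"] show ?thesis
    by (simp add: dir_deriv_def c0_def[symmetric] tangent_space_transition[OF v c c0])
qed

lemma dir_deriv_in_chart:
  assumes "f \<in> smooth_functions A" "X \<in> vector_fields A" "c \<in> A" "x \<in> snd c ` fst c"
  shows "frechet_derivative (f \<circ> chart_inv c) (at x) (vf_coords X c x) =
    ((\<lambda>p. dir_deriv A p (X p) f) \<circ> chart_inv c) x"
proof -
  have "c \<in> charts_at A (chart_inv c x)"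
    using assms(3,4) chart_inv_in by (simp add: charts_at_def)
  then show ?thesis
    using dir_deriv_chart[OF assms(1) vector_field_tangent[OF assms(2)]] chart_chart_inv[OF assms(4)]
    by (simp add: vf_coords_def)
qed

lemma smooth_functions_dir_deriv:
  assumes f: "f \<in> smooth_functions A" and X: "X \<in> vector_fields A"
  shows "(\<lambda>p. dir_deriv A p (X p) f) \<in> smooth_functions A"
proof -
  have "smooth_on (snd c ` fst c) ((\<lambda>p. dir_deriv A p (X p) f) \<circ> chart_inv c)" if c: "c \<in> A" for c
    using f X c
    by (intro smooth_on_cong[OF _ dir_deriv_in_chart[OF f X c]] smooth_on_apply_derivative open_chart_range)
       (auto simp: smooth_functions_def vector_fields_def)
  then show ?thesis by (simp add: smooth_functions_def)
qed

text \<open>In a chart, \<open>X (Y f)\<close> is \<open>D\<^sup>2F(X, Y) + DF(DY(X))\<close>. The second-order terms cancel by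
symmetry, and \<open>DY(X) - DX(Y)\<close> is the coordinate expression of the bracket.\<close>

lemma dir_deriv_lie_bracket:
  assumes f: "f \<in> smooth_functions A" and X: "X \<in> vector_fields A" and Y: "Y \<in> vector_fields A"
    and XY: "lie_bracket A X Y \<in> vector_fields A" and c: "c \<in> charts_at A p"
  shows "dir_deriv A p (lie_bracket A X Y p) f =
    dir_deriv A p (X p) (\<lambda>q. dir_deriv A q (Y q) f) - dir_deriv A p (Y p) (\<lambda>q. dir_deriv A q (X q) f)"
proof -
  have cA: "c \<in> A" "p \<in> fst c" using c by (auto simp: charts_at_def)
  define x where "x = snd c p"
  have x: "x \<in> snd c ` fst c" "chart_inv c x = p" using cA by (auto simp: x_def chart_inv_chart)
  define F where "F = f \<circ> chart_inv c"
  note S = open_chart_range[OF cA(1)]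
  have smooth: "smooth_on (snd c ` fst c) F" using f cA by (simp add: F_def smooth_functions_def)
  then have C2: "Ck_on 2 (snd c ` fst c) F" by (simp add: smooth_on_def)
  have lin: "linear (frechet_derivative F (at x))"
    using has_derivative_linear[OF smooth_on_has_derivative[OF smooth x(1)]] .
  have second: "dir_deriv A p (X p) (\<lambda>q. dir_deriv A q (Y q) f) =
      frechet_derivative (\<lambda>y. frechet_derivative F (at y) (vf_coords Y c x)) (at x) (vf_coords X c x) +
      frechet_derivative F (at x) (frechet_derivative (vf_coords Y c) (at x) (vf_coords X c x))"
    if X: "X \<in> vector_fields A" and Y: "Y \<in> vector_fields A" for X Y
  proof -
    have Y': "(vf_coords Y c has_derivative frechet_derivative (vf_coords Y c) (at x)) (at x)"
      using Y cA x by (intro smooth_on_has_derivative[of "snd c ` fst c"]) (auto simp: vector_fields_def)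
    have "smooth_on (snd c ` fst c) (\<lambda>y. frechet_derivative F (at y) (vf_coords Y c y))"
      using Y cA by (intro smooth_on_apply_derivative S smooth) (auto simp: vector_fields_def)
    from smooth_on_has_derivative[OF this x(1)]
    have "(\<lambda>y. frechet_derivative F (at y) (vf_coords Y c y)) differentiable (at x)"
      by (rule differentiableI)
    from frechet_derivative_transform_within_open[OF this[unfolded F_def] S x(1) dir_deriv_in_chart[OF f Y cA(1)]]
    have "frechet_derivative (\<lambda>y. frechet_derivative F (at y) (vf_coords Y c y)) (at x) =
        frechet_derivative ((\<lambda>q. dir_deriv A q (Y q) f) \<circ> chart_inv c) (at x)"
      unfolding F_def .
    moreover have "dir_deriv A p (X p) (\<lambda>q. dir_deriv A q (Y q) f) =
        frechet_derivative ((\<lambda>q. dir_deriv A q (Y q) f) \<circ> chart_inv c) (at x) (vf_coords X c x)"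
      using dir_deriv_chart[OF smooth_functions_dir_deriv[OF f Y] vector_field_tangent[OF X] c] x
      by (simp add: x_def vf_coords_def)
    ultimately show ?thesis by (simp only: frechet_derivative_apply[OF S C2 x(1) Y', symmetric])
  qed
  have "dir_deriv A p (lie_bracket A X Y p) f = frechet_derivative F (at x) (lie_bracket A X Y p c)"
    using dir_deriv_chart[OF f vector_field_tangent[OF XY] c] by (simp add: F_def x_def)
  also have "lie_bracket A X Y p c = frechet_derivative (vf_coords Y c) (at x) (vf_coords X c x)
      - frechet_derivative (vf_coords X c) (at x) (vf_coords Y c x)"
    using c x by (simp add: lie_bracket_def x_def vf_coords_def)
  finally show ?thesis
    using linear_diff[OF lin] second[OF X Y] second[OF Y X] frechet_derivative_commute[OF S C2 x(1), of "vf_coords X c x" "vf_coords Y c x"]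
    by simp
qed

end

section \<open>Curvature and the Jacobi operator\<close>

context
  fixes T :: "'a topology" and A :: "('a, 'n::finite) chart set"
    and g :: "('a, 'n) metric" and nabla :: "('a, 'n) connection"
  assumes mfd: "smooth_manifold T A"
    and lc: "levi_civita A g nabla"
begin

lemma nabla_in: "X \<in> vector_fields A \<Longrightarrow> Y \<in> vector_fields A \<Longrightarrow> nabla X Y \<in> vector_fields A"
  using lc by (simp add: levi_civita_def affine_connection_def)

lemma nabla_add_left:
  "X \<in> vector_fields A \<Longrightarrow> Y \<in> vector_fields A \<Longrightarrow> Z \<in> vector_fields A \<Longrightarrow>
    nabla (X + Y) Z = nabla X Z + nabla Y Z"
  using lc unfolding levi_civita_def affine_connection_def by blast

lemma nabla_add_right:
  "X \<in> vector_fields A \<Longrightarrow> Y \<in> vector_fields A \<Longrightarrow> Z \<in> vector_fields A \<Longrightarrow>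
    nabla X (Y + Z) = nabla X Y + nabla X Z"
  using lc unfolding levi_civita_def affine_connection_def by blast

lemma nabla_scale_left:
  "f \<in> smooth_functions A \<Longrightarrow> X \<in> vector_fields A \<Longrightarrow> Y \<in> vector_fields A \<Longrightarrow>
    nabla (\<lambda>p. f p *\<^sub>R X p) Y = (\<lambda>p. f p *\<^sub>R nabla X Y p)"
  using lc unfolding levi_civita_def affine_connection_def by blast

lemma nabla_leibniz:
  "f \<in> smooth_functions A \<Longrightarrow> X \<in> vector_fields A \<Longrightarrow> Y \<in> vector_fields A \<Longrightarrow>
    nabla X (\<lambda>p. f p *\<^sub>R Y p) = (\<lambda>p. f p *\<^sub>R nabla X Y p + dir_deriv A p (X p) f *\<^sub>R Y p)"
  using lc unfolding levi_civita_def affine_connection_def by blast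

lemma nabla_torsion_free:
  "X \<in> vector_fields A \<Longrightarrow> Y \<in> vector_fields A \<Longrightarrow> lie_bracket A X Y = nabla X Y - nabla Y X"
  using lc by (simp add: levi_civita_def)

lemma nabla_metric:
  "X \<in> vector_fields A \<Longrightarrow> Y \<in> vector_fields A \<Longrightarrow> Z \<in> vector_fields A \<Longrightarrow> c \<in> charts_at A p \<Longrightarrow>
    dir_deriv A p (X p) (\<lambda>q. g q (Y q) (Z q)) = g p (nabla X Y p) (Z p) + g p (Y p) (nabla X Z p)"
  using lc unfolding levi_civita_def charts_at_def by blast

lemma nabla_diff_left:
  assumes "X \<in> vector_fields A" "Y \<in> vector_fields A" "Z \<in> vector_fields A"
  shows "nabla (X - Y) Z = nabla X Z - nabla Y Z"
  using nabla_add_left[OF vector_fields_diff[OF mfd assms(1,2)] assms(2,3)]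
  by (simp add: algebra_simps)

lemma lie_bracket_in:
  "X \<in> vector_fields A \<Longrightarrow> Y \<in> vector_fields A \<Longrightarrow> lie_bracket A X Y \<in> vector_fields A"
  by (simp add: nabla_torsion_free vector_fields_diff[OF mfd] nabla_in)

lemma curvature_in:
  "X \<in> vector_fields A \<Longrightarrow> Y \<in> vector_fields A \<Longrightarrow> Z \<in> vector_fields A \<Longrightarrow>
    curvature A nabla X Y Z \<in> vector_fields A"
  unfolding curvature_def by (intro vector_fields_diff[OF mfd] nabla_in lie_bracket_in)

text \<open>In \<open>\<nabla>\<^sub>Y (f \<nabla>\<^sub>X Z)\<close> and in \<open>\<nabla>\<^bsub>[fX,Y]\<^esub> Z\<close> the derivative \<open>h = Y f\<close> appears with opposite
effect, and the terms \<open>h \<nabla>\<^sub>X Z\<close> cancel. The bracket \<open>[fX, Y] = f [X, Y] - h X\<close> follows from the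
vanishing torsion, without coordinates.\<close>

lemma curvature_scale_left:
  assumes f: "f \<in> smooth_functions A"
    and X: "X \<in> vector_fields A" and Y: "Y \<in> vector_fields A" and Z: "Z \<in> vector_fields A"
  shows "curvature A nabla (\<lambda>p. f p *\<^sub>R X p) Y Z = (\<lambda>p. f p *\<^sub>R curvature A nabla X Y Z p)"
proof -
  define h where "h = (\<lambda>p. dir_deriv A p (Y p) f)"
  have h: "h \<in> smooth_functions A" unfolding h_def by (rule smooth_functions_dir_deriv[OF mfd f Y])
  note scale = vector_fields_scale[OF mfd]
  have "lie_bracket A (\<lambda>p. f p *\<^sub>R X p) Y = (\<lambda>p. f p *\<^sub>R lie_bracket A X Y p) - (\<lambda>p. h p *\<^sub>R X p)"
    by (rule ext)
       (simp add: nabla_torsion_free scale f X Y nabla_scale_left nabla_leibniz h_def scaleR_diff_right)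
  then have "nabla (lie_bracket A (\<lambda>p. f p *\<^sub>R X p) Y) Z =
      (\<lambda>p. f p *\<^sub>R nabla (lie_bracket A X Y) Z p) - (\<lambda>p. h p *\<^sub>R nabla X Z p)"
    by (simp add: nabla_diff_left scale f h X Y Z lie_bracket_in nabla_scale_left)
  then show ?thesis
    by (intro ext)
       (simp add: curvature_def nabla_scale_left nabla_leibniz nabla_in f X Y Z h_def scaleR_diff_right)
qed

lemma curvature_add_left:
  assumes "X \<in> vector_fields A" "X' \<in> vector_fields A" "Y \<in> vector_fields A" "Z \<in> vector_fields A"
  shows "curvature A nabla (X + X') Y Z = curvature A nabla X Y Z + curvature A nabla X' Y Z"
proof -
  note VF = assms nabla_in vector_fields_add[OF mfd] lie_bracket_in
  have "lie_bracket A (X + X') Y = lie_bracket A X Y + lie_bracket A X' Y"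
    by (simp add: nabla_torsion_free VF nabla_add_left nabla_add_right)
  then show ?thesis
    by (simp add: curvature_def VF nabla_add_left nabla_add_right)
qed

lemma curvature_lincomb_left:
  assumes "X \<in> vector_fields A" "X' \<in> vector_fields A" "Y \<in> vector_fields A" "Z \<in> vector_fields A"
  shows "curvature A nabla (\<lambda>p. a *\<^sub>R X p + b *\<^sub>R X' p) Y Z p =
    a *\<^sub>R curvature A nabla X Y Z p + b *\<^sub>R curvature A nabla X' Y Z p"
proof -
  note const = smooth_functions_const[OF mfd]
  have "(\<lambda>p. a *\<^sub>R X p + b *\<^sub>R X' p) = (\<lambda>p. a *\<^sub>R X p) + (\<lambda>p. b *\<^sub>R X' p)" by (simp add: plus_fun_def)
  then show ?thesis
    using curvature_add_left[OF vector_fields_scale[OF mfd const assms(1)] vector_fields_scale[OF mfd const assms(2)] assms(3,4)]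
    by (simp add: curvature_scale_left[OF const] assms)
qed

lemma curvature_sum_left:
  assumes "finite I" "\<And>i. i \<in> I \<Longrightarrow> f i \<in> smooth_functions A" "\<And>i. i \<in> I \<Longrightarrow> X i \<in> vector_fields A"
    and YZ: "Y \<in> vector_fields A" "Z \<in> vector_fields A"
  shows "(\<lambda>p. \<Sum>i\<in>I. f i p *\<^sub>R X i p) \<in> vector_fields A \<and>
    curvature A nabla (\<lambda>p. \<Sum>i\<in>I. f i p *\<^sub>R X i p) Y Z = (\<lambda>p. \<Sum>i\<in>I. f i p *\<^sub>R curvature A nabla (X i) Y Z p)"
  using assms(1-3)
proof (induction I rule: finite_induct)
  case empty
  have "curvature A nabla (\<lambda>p. 0) Y Z = (\<lambda>p. 0)"
    using curvature_scale_left[OF smooth_functions_const[OF mfd, of 0] YZ(1) YZ] by simp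
  then show ?case using vector_fields_zero[OF mfd] by (simp add: zero_fun_def)
next
  case (insert i I)
  let ?S = "\<lambda>p. \<Sum>i\<in>I. f i p *\<^sub>R X i p"
  have S: "?S \<in> vector_fields A" "curvature A nabla ?S Y Z = (\<lambda>p. \<Sum>i\<in>I. f i p *\<^sub>R curvature A nabla (X i) Y Z p)"
    using insert by auto
  have fX: "f i \<in> smooth_functions A" "X i \<in> vector_fields A" using insert.prems by auto
  have split: "(\<lambda>p. \<Sum>i\<in>insert i I. f i p *\<^sub>R X i p) = (\<lambda>p. f i p *\<^sub>R X i p) + ?S"
    using insert.hyps by (simp add: plus_fun_def)
  show ?case
    unfolding split
    using vector_fields_add[OF mfd vector_fields_scale[OF mfd fX] S(1)]
      curvature_add_left[OF vector_fields_scale[OF mfd fX] S(1) YZ] insert.hyps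
    by (simp add: S(2) curvature_scale_left[OF fX YZ] plus_fun_def)
qed

text \<open>Near \<open>p\<close>, \<open>X\<close> is a combination \<open>\<Sum> X\<^sup>i \<partial>\<^sub>i\<close> whose coefficients vanish at \<open>p\<close>, so the claim
should follow from linearity over functions. To have global objects, the equation is multiplied by
\<open>\<psi>\<^sup>2\<close> for a bump function \<open>\<psi>\<close>: one factor cuts off \<open>X\<^sup>i\<close>, the other \<open>\<partial>\<^sub>i\<close>. At \<open>p\<close>, where \<open>\<psi>\<close> is
\<open>1\<close>, the factor disappears.\<close>

lemma curvature_eq_0_at:
  assumes X: "X \<in> vector_fields A" and Y: "Y \<in> vector_fields A" and Z: "Z \<in> vector_fields A"
    and c: "c \<in> charts_at A p" and Xp: "X p = 0"
  shows "curvature A nabla X Y Z p = 0"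
proof -
  have cA: "c \<in> A" "p \<in> fst c" using c by (auto simp: charts_at_def)
  obtain \<phi> K where b: "smooth_on UNIV \<phi>" "\<phi> (snd c p) = (1::real)" "compact K" "K \<subseteq> snd c ` fst c"
    "\<And>x. x \<notin> K \<Longrightarrow> \<phi> x = 0" using bump_in_chart[OF mfd c] by blast
  note cutoff_fun = smooth_functions_cutoff[OF mfd cA(1) b(3,4,1,5)]
    and cutoff_field = vector_fields_cutoff[OF mfd cA(1) b(3,4,1,5)]
  define \<psi> where "\<psi> = (\<lambda>q. if q \<in> fst c then \<phi> (snd c q) * 1 else 0)"
  define f where "f = (\<lambda>i q. if q \<in> fst c then \<phi> (snd c q) * (vf_coords X c (snd c q) $ i) else 0)"
  define E where "E = (\<lambda>i q. if q \<in> fst c then tangent_at A c q (\<phi> (snd c q) *\<^sub>R axis i 1) else 0)"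
  have \<psi>: "\<psi> \<in> smooth_functions A" unfolding \<psi>_def by (rule cutoff_fun[OF _ smooth_on_const])
  have f: "f i \<in> smooth_functions A" for i
    unfolding f_def using X cA
    by (intro cutoff_fun smooth_on_bounded_linear_comp[OF open_chart_range[OF mfd] bounded_linear_vec_nth])
       (auto simp: vector_fields_def)
  have E: "E i \<in> vector_fields A" for i unfolding E_def by (rule cutoff_field[OF _ smooth_on_const])
  have eq: "(\<lambda>q. (\<psi> q * \<psi> q) *\<^sub>R X q) = (\<lambda>q. \<Sum>i\<in>UNIV. f i q *\<^sub>R E i q)"
  proof
    fix q
    show "(\<psi> q * \<psi> q) *\<^sub>R X q = (\<Sum>i\<in>UNIV. f i q *\<^sub>R E i q)"
    proof (cases "q \<in> fst c")
      case True
      then have cq: "c \<in> charts_at A q" using cA by (simp add: charts_at_def)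
      note lin = linear_tangent_at[OF mfd cq]
      have "(\<Sum>i\<in>UNIV. f i q *\<^sub>R E i q) =
          tangent_at A c q (\<Sum>i\<in>UNIV. (f i q * \<phi> (snd c q)) *\<^sub>R axis i 1)"
        using True by (simp add: E_def linear_sum[OF lin] linear_cmul[OF lin])
      also have "(\<Sum>i\<in>UNIV. (f i q * \<phi> (snd c q)) *\<^sub>R axis i 1) =
          (\<psi> q * \<psi> q) *\<^sub>R (\<Sum>i\<in>UNIV. (X q c $ i) *\<^sub>R axis i 1)"
        using True cA
        by (simp add: scaleR_sum_right f_def \<psi>_def vf_coords_def chart_inv_chart[OF mfd] ac_simps)
      also have "(\<Sum>i\<in>UNIV. (X q c $ i) *\<^sub>R axis i 1) = X q c"
        using basis_expansion[of "X q c"] by (simp add: scalar_mult_eq_scaleR)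
      finally show ?thesis
        by (simp add: linear_cmul[OF lin] tangent_at_coords[OF mfd cq vector_field_tangent[OF mfd X]])
    qed (simp add: \<psi>_def f_def)
  qed
  have "curvature A nabla X Y Z p = (\<psi> p * \<psi> p) *\<^sub>R curvature A nabla X Y Z p"
    using cA b(2) by (simp add: \<psi>_def)
  also have "\<dots> = curvature A nabla (\<lambda>q. (\<psi> q * \<psi> q) *\<^sub>R X q) Y Z p"
    by (simp add: curvature_scale_left[OF smooth_functions_mult[OF mfd \<psi> \<psi>] X Y Z])
  also have "\<dots> = (\<Sum>i\<in>UNIV. f i p *\<^sub>R curvature A nabla (E i) Y Z p)"
    unfolding eq
    by (rule fun_cong[OF conjunct2[OF curvature_sum_left[of UNIV f E, OF finite f E Y Z]]])
  also have "\<dots> = 0"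
    using Xp cA by (simp add: f_def vf_coords_def chart_inv_chart[OF mfd])
  finally show ?thesis .
qed

text \<open>Two fields with the same value at \<open>p\<close> differ by a field that vanishes at \<open>p\<close>, so the
description in the definition of \<open>jacobi_operator\<close> is unique.\<close>

lemma jacobi_operator_eq_curvature:
  assumes X: "X \<in> vector_fields A" and \<xi>: "\<xi> \<in> vector_fields A" and c: "c \<in> charts_at A p"
  shows "jacobi_operator A nabla \<xi> p (X p) = curvature A nabla X \<xi> \<xi> p"
  unfolding jacobi_operator_def
proof (rule the_equality)
  fix w assume "\<exists>X'\<in>vector_fields A. X' p = X p \<and> w = curvature A nabla X' \<xi> \<xi> p"
  then obtain X' where X': "X' \<in> vector_fields A" "X' p = X p" "w = curvature A nabla X' \<xi> \<xi> p" by auto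
  let ?D = "\<lambda>p. 1 *\<^sub>R X' p + (-1) *\<^sub>R X p"
  have "?D \<in> vector_fields A" using vector_fields_diff[OF mfd X'(1) X] by (simp add: fun_diff_def)
  then have "curvature A nabla ?D \<xi> \<xi> p = 0"
    by (rule curvature_eq_0_at[OF _ \<xi> \<xi> c]) (simp add: X')
  then show "w = curvature A nabla X \<xi> \<xi> p"
    using curvature_lincomb_left[OF X'(1) X \<xi> \<xi>, of 1 "-1" p] X'(3) by simp
qed (use X in blast)

lemma curvature_self:
  assumes X: "X \<in> vector_fields A" and Z: "Z \<in> vector_fields A"
  shows "curvature A nabla X X Z = 0"
proof -
  have "lie_bracket A X X = 0" by (simp add: nabla_torsion_free X)
  then show ?thesis using nabla_diff_left[OF X X Z] by (simp add: curvature_def)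
qed

lemma jacobi_operator_lincomb:
  assumes \<xi>: "\<xi> \<in> vector_fields A" and c: "c \<in> charts_at A p"
    and u: "u \<in> tangent_space A p" and v: "v \<in> tangent_space A p"
  shows "jacobi_operator A nabla \<xi> p (a *\<^sub>R u + b *\<^sub>R v) =
    a *\<^sub>R jacobi_operator A nabla \<xi> p u + b *\<^sub>R jacobi_operator A nabla \<xi> p v"
proof -
  obtain X where X: "X \<in> vector_fields A" "X p = u" using vector_field_through[OF mfd c u] .
  obtain Y where Y: "Y \<in> vector_fields A" "Y p = v" using vector_field_through[OF mfd c v] .
  have "(\<lambda>p. a *\<^sub>R X p + b *\<^sub>R Y p) \<in> vector_fields A"
    by (rule vector_fields_lincomb[OF mfd smooth_functions_const[OF mfd] smooth_functions_const[OF mfd] X(1) Y(1)])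
  from jacobi_operator_eq_curvature[OF this \<xi> c] show ?thesis
    using jacobi_operator_eq_curvature[OF X(1) \<xi> c] jacobi_operator_eq_curvature[OF Y(1) \<xi> c]
    by (simp add: curvature_lincomb_left X Y \<xi>)
qed

lemma jacobi_operator_in:
  assumes \<xi>: "\<xi> \<in> vector_fields A" and c: "c \<in> charts_at A p" and v: "v \<in> tangent_space A p"
  shows "jacobi_operator A nabla \<xi> p v \<in> tangent_space A p"
proof -
  obtain X where X: "X \<in> vector_fields A" "X p = v" using vector_field_through[OF mfd c v] .
  then show ?thesis
    using jacobi_operator_eq_curvature[OF X(1) \<xi> c] vector_field_tangent[OF mfd curvature_in[OF X(1) \<xi> \<xi>]]
    by simp
qed

text \<open>For points outside all charts \<open>dir_deriv\<close> is a junk value, so functions built from it can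
only be compared on chart domains.\<close>

lemma dir_deriv_cong:
  assumes "f \<in> smooth_functions A" "h \<in> smooth_functions A" "v \<in> tangent_space A p" "c \<in> charts_at A p"
    and eq: "\<And>q. q \<in> fst c \<Longrightarrow> f q = h q"
  shows "dir_deriv A p v f = dir_deriv A p v h"
proof -
  have cA: "c \<in> A" "p \<in> fst c" using assms(4) by (auto simp: charts_at_def)
  have x: "snd c p \<in> snd c ` fst c" using cA by simp
  have "smooth_on (snd c ` fst c) (f \<circ> chart_inv c)" using assms(1) cA by (simp add: smooth_functions_def)
  from differentiableI[OF smooth_on_has_derivative[OF this x]]
  have "frechet_derivative (f \<circ> chart_inv c) (at (snd c p)) = frechet_derivative (h \<circ> chart_inv c) (at (snd c p))"
    by (rule frechet_derivative_transform_within_open[OF _ open_chart_range[OF mfd cA(1)] x])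
       (use eq in \<open>auto simp: chart_inv_chart[OF mfd cA(1)]\<close>)
  then show ?thesis by (simp add: dir_deriv_chart[OF mfd _ assms(3,4)] assms(1,2))
qed

context
  assumes pg: "pseudo_riemannian_metric A g"
begin

lemma metric_lincomb_left:
  assumes "u \<in> tangent_space A p" "v \<in> tangent_space A p" "w \<in> tangent_space A p"
  shows "g p (a *\<^sub>R u + b *\<^sub>R v) w = a * g p u w + b * g p v w"
  using pg[unfolded pseudo_riemannian_metric_def, THEN conjunct1] assms by simp

lemma metric_sym:
  assumes "u \<in> tangent_space A p" "v \<in> tangent_space A p"
  shows "g p u v = g p v u"
  using pg[unfolded pseudo_riemannian_metric_def, THEN conjunct2, THEN conjunct1, rule_format, OF assms] .

lemma metric_smooth:
  "X \<in> vector_fields A \<Longrightarrow> Y \<in> vector_fields A \<Longrightarrow> (\<lambda>p. g p (X p) (Y p)) \<in> smooth_functions A"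
  using pg unfolding pseudo_riemannian_metric_def by blast

text \<open>With \<open>h = g(Z, Z)\<close>, metric compatibility gives \<open>U h = 2 g(\<nabla>\<^sub>U Z, Z)\<close> and
\<open>V (U h) = 2 g(\<nabla>\<^sub>V \<nabla>\<^sub>U Z, Z) + 2 g(\<nabla>\<^sub>U Z, \<nabla>\<^sub>V Z)\<close>. In \<open>X Y h - Y X h - [X, Y] h = 0\<close> the symmetric
terms cancel and what is left is \<open>2 g(R\<^bsub>XY\<^esub> Z, Z)\<close>.\<close>

lemma metric_curvature_skew:
  assumes X: "X \<in> vector_fields A" and Y: "Y \<in> vector_fields A" and Z: "Z \<in> vector_fields A"
    and c: "c \<in> charts_at A p"
  shows "g p (curvature A nabla X Y Z p) (Z p) = 0"
proof -
  note tan = vector_field_tangent[OF mfd] and VF = X Y Z nabla_in vector_fields_add[OF mfd] lie_bracket_in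
  define h where "h = (\<lambda>q. g q (Z q) (Z q))"
  have h: "h \<in> smooth_functions A" unfolding h_def by (rule metric_smooth[OF Z Z])
  have add: "g q ((U + V) q) (W q) = g q (U q) (W q) + g q (V q) (W q)"
    if "U \<in> vector_fields A" "V \<in> vector_fields A" "W \<in> vector_fields A" for U V W q
    using metric_lincomb_left[of "U q" q "V q" "W q" 1 1] that by (simp add: tan)
  have sub: "g q ((U - V) q) (W q) = g q (U q) (W q) - g q (V q) (W q)"
    if "U \<in> vector_fields A" "V \<in> vector_fields A" "W \<in> vector_fields A" for U V W q
    using metric_lincomb_left[of "U q" q "V q" "W q" 1 "-1"] that by (simp add: tan)
  have first: "dir_deriv A q (U q) h = g q ((nabla U Z + nabla U Z) q) (Z q)"
    if U: "U \<in> vector_fields A" and "c' \<in> charts_at A q" for U q c'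
    using nabla_metric[OF U Z Z that(2)] metric_sym[OF tan[OF Z, of q] tan[OF nabla_in[OF U Z], of q]]
    by (simp only: h_def add[OF nabla_in[OF U Z] nabla_in[OF U Z] Z])
  have second: "dir_deriv A p (V p) (\<lambda>q. dir_deriv A q (U q) h) =
      2 * g p (nabla V (nabla U Z) p) (Z p) + 2 * g p (nabla U Z p) (nabla V Z p)"
    if U: "U \<in> vector_fields A" and V: "V \<in> vector_fields A" for U V
  proof -
    note UZ = nabla_in[OF U Z]
    have "dir_deriv A p (V p) (\<lambda>q. dir_deriv A q (U q) h) =
        dir_deriv A p (V p) (\<lambda>q. g q ((nabla U Z + nabla U Z) q) (Z q))"
    proof (rule dir_deriv_cong[OF smooth_functions_dir_deriv[OF mfd h U] metric_smooth tan[OF V] c])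
      fix q assume "q \<in> fst c"
      then have "c \<in> charts_at A q" using c by (simp add: charts_at_def)
      then show "dir_deriv A q (U q) h = g q ((nabla U Z + nabla U Z) q) (Z q)" by (rule first[OF U])
    qed (intro vector_fields_add[OF mfd] UZ Z)+
    also have "\<dots> = g p ((nabla V (nabla U Z) + nabla V (nabla U Z)) p) (Z p)
        + g p ((nabla U Z + nabla U Z) p) (nabla V Z p)"
      by (simp only: nabla_metric[OF V vector_fields_add[OF mfd UZ UZ] Z c] nabla_add_right[OF V UZ UZ])
    also have "\<dots> = 2 * g p (nabla V (nabla U Z) p) (Z p) + 2 * g p (nabla U Z p) (nabla V Z p)"
      by (simp only: add[OF nabla_in[OF V UZ] nabla_in[OF V UZ] Z] add[OF UZ UZ nabla_in[OF V Z]])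
    finally show ?thesis .
  qed
  have "dir_deriv A p (lie_bracket A X Y p) h = 2 * g p (nabla (lie_bracket A X Y) Z p) (Z p)"
    using first[OF lie_bracket_in[OF X Y] c] add[OF nabla_in nabla_in Z, of "lie_bracket A X Y" Z "lie_bracket A X Y" Z p]
    by (simp only: lie_bracket_in X Y Z)
  then have "2 * g p (nabla (lie_bracket A X Y) Z p) (Z p) =
      2 * g p (nabla X (nabla Y Z) p) (Z p) - 2 * g p (nabla Y (nabla X Z) p) (Z p)"
    using dir_deriv_lie_bracket[OF mfd h X Y lie_bracket_in[OF X Y] c]
      second[OF X Y] second[OF Y X] metric_sym[of "nabla X Z p" p "nabla Y Z p"]
    by (simp add: tan VF)
  moreover have "g p (curvature A nabla X Y Z p) (Z p) = g p (nabla X (nabla Y Z) p) (Z p)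
      - g p (nabla Y (nabla X Z) p) (Z p) - g p (nabla (lie_bracket A X Y) Z p) (Z p)"
    unfolding curvature_def
    by (simp add: sub VF vector_fields_diff[OF mfd] del: minus_apply fun_diff_def)
  ultimately show ?thesis by simp
qed

lemma jacobi_rank_iff_omega_at:
  assumes \<xi>: "\<xi> \<in> vector_fields A" and c: "c \<in> charts_at A p" and nz: "g p (\<xi> p) (\<xi> p) \<noteq> 0"
  shows "jacobi_rank A nabla \<xi> p = CARD('n) - 1 \<longleftrightarrow> jacobi_omega A nabla (CARD('n) - 1) \<xi> p \<noteq> 0"
proof -
  define b :: "'n \<Rightarrow> ('a, 'n) tangent" where "b = (SOME b. is_basis (tangent_space A p) b)"
  have b: "is_basis (tangent_space A p) b"
    unfolding b_def using basis_tangent_space[OF mfd c]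
    by (rule someI[where P = "is_basis (tangent_space A p)"])
  note tan = vector_field_tangent[OF mfd]
  have "jacobi_rank A nabla \<xi> p = CARD('n) - 1 \<longleftrightarrow>
      coeff (char_poly (endo_matrix b (jacobi_operator A nabla \<xi> p))) 1 \<noteq> 0"
    unfolding jacobi_rank_def
  proof (rule dim_image_eq_iff_coeff_1_char_poly[OF b, of _ "\<lambda>v. g p v (\<xi> p)" "\<xi> p"])
    fix v assume v: "v \<in> tangent_space A p"
    obtain X where X: "X \<in> vector_fields A" "X p = v" using vector_field_through[OF mfd c v] .
    then show "g p (jacobi_operator A nabla \<xi> p v) (\<xi> p) = 0"
      using metric_curvature_skew[OF X(1) \<xi> \<xi> c] jacobi_operator_eq_curvature[OF X(1) \<xi> c] by simp
  next
    show "jacobi_operator A nabla \<xi> p (\<xi> p) = 0"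
      using jacobi_operator_eq_curvature[OF \<xi> \<xi> c] curvature_self[OF \<xi> \<xi>] by simp
  qed (use nz in \<open>auto intro: jacobi_operator_in jacobi_operator_lincomb metric_lincomb_left tan \<xi> c\<close>)
  moreover have "CARD('n) - (CARD('n) - 1) = 1"
    using zero_less_card_finite[where 'a = 'n] by linarith
  ultimately show ?thesis
    by (simp add: jacobi_omega_def jacobi_char_poly_def b_def)
qed

end

end

theorem proposition2:
  fixes T :: "'a topology"
    and A :: "('a, 'n::finite) chart set"
    and g :: "('a, 'n) metric"
    and nabla :: "('a, 'n) connection"
    and \<xi> :: "('a, 'n) vfield"
  assumes "smooth_manifold T A"
    and "pseudo_riemannian_metric A g"
    and "levi_civita A g nabla"
    and "\<xi> \<in> vector_fields A"
    and "\<forall>p\<in>topspace T. g p (\<xi> p) (\<xi> p) \<noteq> 0"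
  shows "(\<forall>p\<in>topspace T. jacobi_rank A nabla \<xi> p = CARD('n) - 1) \<longleftrightarrow>
         (\<forall>p\<in>topspace T. jacobi_omega A nabla (CARD('n) - 1) \<xi> p \<noteq> 0)"
proof (rule ball_cong[OF refl])
  fix p assume p: "p \<in> topspace T"
  have "(\<Union>c\<in>A. fst c) = topspace T" using assms(1) unfolding smooth_manifold_def by blast
  then obtain c where "c \<in> A" "p \<in> fst c" using p by blast
  then have "c \<in> charts_at A p" by (simp add: charts_at_def)
  then show "jacobi_rank A nabla \<xi> p = CARD('n) - 1 \<longleftrightarrow> jacobi_omega A nabla (CARD('n) - 1) \<xi> p \<noteq> 0"
    using jacobi_rank_iff_omega_at[OF assms(1,3,2,4)] assms(5) p by blast
qed

end
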